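(* Let $J$ be a conjugation in the complex separable Hilbert space $\mathcal{H}$, and let $\mathbf{C}$ be a map $L^2(\mathcal{H})\to L^2(\mathcal{H})$. Then the following conditions are equivalent: (1) $\mathbf{C}$ is a conjugation in $L^2(\mathcal{H})$ such that $\mathbf{C}\mathbf{M}_z=\mathbf{M}_z\mathbf{C}$; (2) there is $\mathbf{U}\in L^\infty(L(\mathcal{H}))$ such that $\mathbf{U}(z)$ is a unitary operator for almost all $z\in\mathbb{T}$, $M_{\mathbf{U}}$ is $\mathbf{J}^\star$-symmetric, and $\mathbf{C}=M_{\mathbf{U}}\mathbf{J}^\star=\mathbf{J}^\star M_{\mathbf{U}^*}$.
   Context: $\mathbb{T}$ is the unit circle with normalized Lebesgue measure $m$; $\mathcal{H}$ is a complex separable Hilbert space and $L(\mathcal{H})$ the algebra of bounded linear operators on it. A conjugation on a Hilbert space $\mathcal{K}$ is an antilinear map $C:\mathcal{K}\to\mathcal{K}$ with $C^2=I$ and $\langle Cf,Cg\rangle=\langle g,f\rangle$ for all $f,g$. A bounded linear operator $A$ on $\mathcal{K}$ is $C$-symmetric if $CAC=A^*$. $L^2(\mathcal{H})$ is the Hilbert space of (classes of) measurable $\mathbf{f}:\mathbb{T}\to\mathcal{H}$ with $\int_{\mathbb{T}}\|\mathbf{f}(z)\|^2dm<\infty$ and inner product $\int_{\mathbb{T}}\langle\mathbf{f}(z),\mathbf{g}(z)\rangle dm(z)$. $L^\infty(L(\mathcal{H}))$ is the space of (classes of) essentially bounded $\mathbf{F}:\mathbb{T}\to L(\mathcal{H})$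 that are measurable, i.e. $z\mapsto\mathbf{F}(z)x$ is measurable for every $x\in\mathcal{H}$. For such $\mathbf{F}$, $(M_{\mathbf{F}}\mathbf{f})(z)=\mathbf{F}(z)\mathbf{f}(z)$ a.e. and $\mathbf{F}^*(z)=\mathbf{F}(z)^*$ a.e. $(\mathbf{M}_z\mathbf{f})(z)=z\mathbf{f}(z)$. For a conjugation $J$ in $\mathcal{H}$, $\mathbf{J}^\star$ is the conjugation on $L^2(\mathcal{H})$ given by $(\mathbf{J}^\star\mathbf{f})(z)=J(\mathbf{f}(\bar z))$ a.e. on $\mathbb{T}$. *)

theory Defs
  imports "HOL-Analysis.Analysis" "HOL-Probability.Probability_Measure"
begin

section \<open>Complex Hilbert spaces\<close>

text \<open>
  The inner product is linear in the first argument.  The class extends \<^class>\<open>real_inner\<close>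
  by a complex structure whose Hermitian product has the given real inner product as its real
  part; hence the norm is the one induced by \<open>cinner\<close> (lemma \<open>cinner_self\<close> below).
\<close>

class complex_inner = real_inner +
  fixes scaleC :: "complex \<Rightarrow> 'a \<Rightarrow> 'a"  (infixr \<open>*\<^sub>C\<close> 75)
    and cinner :: "'a \<Rightarrow> 'a \<Rightarrow> complex"
  assumes scaleC_add_right: "a *\<^sub>C (x + y) = a *\<^sub>C x + a *\<^sub>C y"
    and scaleC_add_left: "(a + b) *\<^sub>C x = a *\<^sub>C x + b *\<^sub>C x"
    and scaleC_scaleC: "a *\<^sub>C b *\<^sub>C x = (a * b) *\<^sub>C x"
    and scaleC_of_real: "complex_of_real r *\<^sub>C x = r *\<^sub>R x"
    and cinner_commute: "cinner x y = cnj (cinner y x)"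
    and cinner_add_left: "cinner (x + y) z = cinner x z + cinner y z"
    and cinner_scaleC_left: "cinner (a *\<^sub>C x) y = a * cinner x y"
    and Re_cinner: "Re (cinner x y) = inner x y"

class chilbert_space = complex_inner + complete_space

instance chilbert_space \<subseteq> banach ..

lemma cinner_self: "cinner x x = complex_of_real ((norm x)\<^sup>2)"
  using cinner_commute[of x x] Re_cinner[of x x]
  by (simp add: complex_eq_iff power2_norm_eq_inner)

lemma cinner_add_right: "cinner x (y + z) = cinner x y + cinner x z"
  by (metis cinner_add_left cinner_commute complex_cnj_add)

lemma cinner_scaleC_right: "cinner x (a *\<^sub>C y) = cnj a * cinner x y"
  by (metis cinner_commute cinner_scaleC_left complex_cnj_mult)

lemma cinner_eq_Complex: "cinner x y = Complex (inner x y) (inner x (\<i> *\<^sub>C y))"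
  by (simp add: complex_eq_iff Re_cinner cinner_scaleC_right flip: Re_cinner[of x "\<i> *\<^sub>C y"])

lemma scaleC_decomp: "a *\<^sub>C x = Re a *\<^sub>R x + Im a *\<^sub>R \<i> *\<^sub>C x"
proof -
  have "a *\<^sub>C x = (complex_of_real (Re a) + complex_of_real (Im a) * \<i>) *\<^sub>C x"
    by (metis complex_eq mult.commute)
  then show ?thesis
    by (simp only: scaleC_add_left scaleC_of_real flip: scaleC_scaleC)
qed

lemma norm_scaleC: "norm (a *\<^sub>C x) = norm a * norm x"
proof -
  have "complex_of_real ((norm (a *\<^sub>C x))\<^sup>2) = (a * cnj a) * cinner x x"
    by (simp only: flip: cinner_self) (simp add: cinner_scaleC_left cinner_scaleC_right)
  also have "\<dots> = complex_of_real ((norm a * norm x)\<^sup>2)"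
    by (simp only: cinner_self flip: complex_norm_square) (simp add: power_mult_distrib)
  finally have "(norm (a *\<^sub>C x))\<^sup>2 = (norm a * norm x)\<^sup>2"
    by (simp only: of_real_eq_iff)
  then show ?thesis
    by (simp add: power2_eq_iff_nonneg)
qed

lemma bounded_linear_scaleC: "bounded_linear (\<lambda>x::'a::complex_inner. a *\<^sub>C x)"
  by (rule bounded_linear_intro[where K="norm a"])
    (auto simp: scaleC_add_right norm_scaleC scaleC_scaleC mult.commute simp flip: scaleC_of_real)

lemma norm_cinner_le: "norm (cinner x y) \<le> 2 * (norm x * norm y)"
proof -
  have "norm (cinner x y) \<le> \<bar>inner x y\<bar> + \<bar>inner x (\<i> *\<^sub>C y)\<bar>"
    using cmod_le[of "cinner x y"] by (simp add: cinner_eq_Complex)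
  also have "\<dots> \<le> norm x * norm y + norm x * norm (\<i> *\<^sub>C y)"
    by (intro add_mono Cauchy_Schwarz_ineq2)
  finally show ?thesis by (simp add: norm_scaleC)
qed

instantiation complex :: chilbert_space
begin

definition scaleC_complex :: "complex \<Rightarrow> complex \<Rightarrow> complex"
  where "scaleC_complex a x = a * x"

definition cinner_complex :: "complex \<Rightarrow> complex \<Rightarrow> complex"
  where "cinner_complex x y = x * cnj y"

instance
  by standard
    (auto simp: scaleC_complex_def cinner_complex_def algebra_simps inner_complex_def scaleR_conv_of_real)

end

definition bounded_clinear :: "('a::complex_inner \<Rightarrow> 'b::complex_inner) \<Rightarrow> bool"
  where "bounded_clinear A \<longleftrightarrow> bounded_linear A \<and> (\<forall>a x. A (a *\<^sub>C x) = a *\<^sub>C A x)"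

text \<open>For a bounded operator on a Hilbert space the operator described here exists and is unique.\<close>

definition cadjoint :: "('a::chilbert_space \<Rightarrow> 'a) \<Rightarrow> 'a \<Rightarrow> 'a"
  where "cadjoint A = (THE B. \<forall>x y. cinner (A x) y = cinner x (B y))"

definition unitary_op :: "('a::chilbert_space \<Rightarrow> 'a) \<Rightarrow> bool"
  where "unitary_op U \<longleftrightarrow> bounded_clinear U \<and> cadjoint U \<circ> U = id \<and> U \<circ> cadjoint U = id"

definition conjugation :: "('a::chilbert_space \<Rightarrow> 'a) \<Rightarrow> bool"
  where "conjugation C \<longleftrightarrow>
    (\<forall>x y. C (x + y) = C x + C y) \<and> (\<forall>a x. C (a *\<^sub>C x) = cnj a *\<^sub>C C x) \<and>
    C \<circ> C = id \<and> (\<forall>f g. cinner (C f) (C g) = cinner g f)"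

definition C_symmetric :: "('a::chilbert_space \<Rightarrow> 'a) \<Rightarrow> ('a \<Rightarrow> 'a) \<Rightarrow> bool"
  where "C_symmetric C A \<longleftrightarrow> bounded_clinear A \<and> C \<circ> A \<circ> C = cadjoint A"

lemma cadjoint_eqI:
  assumes "\<And>x y. cinner (A x) y = cinner x (B y)"
  shows "cadjoint A = B"
  unfolding cadjoint_def
proof (rule the_equality)
  fix B' assume B': "\<forall>x y. cinner (A x) y = cinner x (B' y)"
  have "inner (B' y - B y) (B' y) = inner (B' y - B y) (B y)" for y
    using B' assms by (metis Re_cinner)
  then have "inner (B' y - B y) (B' y - B y) = 0" for y
    by (simp add: inner_diff_right)
  then show "B' = B"
    by (intro ext) simp
qed (use assms in blast)


section \<open>The unit circle with normalized Lebesgue measure\<close>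

text \<open>
  The measure space whose underlying set is the unit circle; its \<open>\<sigma>\<close>-algebra is the completed
  one, that is, the Lebesgue measurable subsets of the circle.
\<close>

definition circle_borel :: "complex measure"
  where "circle_borel = distr (uniform_measure lborel {0..<1::real})
    (restrict_space borel (sphere 0 1)) (\<lambda>t. cis (2 * pi * t))"

definition circle_measure :: "complex measure"
  where "circle_measure = completion circle_borel"

lemma measurable_cis_circle:
  "(\<lambda>t. cis (2 * pi * t)) \<in> uniform_measure lborel {0..<1::real} \<rightarrow>\<^sub>M restrict_space borel (sphere 0 1)"
proof (rule measurable_restrict_space2)
  have "(\<lambda>t. cis (2 * pi * t)) \<in> borel_measurable borel"
    by (intro borel_measurable_continuous_onI continuous_intros)
  then show "(\<lambda>t. cis (2 * pi * t)) \<in> borel_measurable (uniform_measure lborel {0..<1::real})"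
    by (simp cong: measurable_cong_sets)
qed auto

lemma space_circle_measure [simp]: "space circle_measure = sphere 0 1"
  by (simp add: circle_measure_def circle_borel_def space_restrict_space)

lemma prob_space_circle_borel: "prob_space circle_borel"
  unfolding circle_borel_def
  by (intro prob_space.prob_space_distr measurable_cis_circle prob_space_uniform_measure) auto

interpretation circle: prob_space circle_measure
  unfolding circle_measure_def
  by (intro prob_space.prob_space_completion prob_space_circle_borel)

interpretation circle: complete_measure circle_measure
  unfolding circle_measure_def ..

lemma measurable_circle_id: "(\<lambda>z. z) \<in> borel_measurable circle_measure"
  unfolding circle_measure_def circle_borel_def
  by (intro measurable_completion) (simp add: measurable_restrict_space1)


section \<open>The space $L^2(\mathcal{H})$ on the circle\<close>

text \<open>Functions are given on all of \<^typ>\<open>complex\<close>; their values off the unit circle are irrelevant.\<close>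

definition square_integrable :: "(complex \<Rightarrow> 'a::{chilbert_space,second_countable_topology}) \<Rightarrow> bool"
  where "square_integrable f \<longleftrightarrow>
    f \<in> borel_measurable circle_measure \<and> integrable circle_measure (\<lambda>z. (norm (f z))\<^sup>2)"

lemma measurable_bounded_linear:
  assumes "bounded_linear T" and "f \<in> borel_measurable M"
  shows "(\<lambda>z. T (f z)) \<in> borel_measurable M"
proof -
  have "T \<in> borel_measurable borel"
    by (intro borel_measurable_continuous_onI linear_continuous_on assms(1))
  then show ?thesis
    by (rule measurable_compose[OF assms(2)])
qed

lemma square_integrable_bound:
  fixes f :: "complex \<Rightarrow> 'a::{chilbert_space,second_countable_topology}"
    and g :: "complex \<Rightarrow> 'b::{chilbert_space,second_countable_topology}"
  assumes "square_integrable f" and "g \<in> borel_measurable circle_measure"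
    and "AE z in circle_measure. norm (g z) \<le> B * norm (f z)"
  shows "square_integrable g"
proof -
  have [measurable]: "g \<in> borel_measurable circle_measure" by fact
  have dom: "AE z in circle_measure. norm ((norm (g z))\<^sup>2) \<le> norm (B\<^sup>2 * (norm (f z))\<^sup>2)"
    using assms(3)
  proof eventually_elim
    fix z assume "norm (g z) \<le> B * norm (f z)"
    then have "(norm (g z))\<^sup>2 \<le> (B * norm (f z))\<^sup>2" by (intro power_mono) auto
    then show "norm ((norm (g z))\<^sup>2) \<le> norm (B\<^sup>2 * (norm (f z))\<^sup>2)"
      by (simp add: power_mult_distrib)
  qed
  have "integrable circle_measure (\<lambda>z. B\<^sup>2 * (norm (f z))\<^sup>2)"
    using assms(1) by (auto simp: square_integrable_def)
  then have "integrable circle_measure (\<lambda>z. (norm (g z))\<^sup>2)"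
    by (rule Bochner_Integration.integrable_bound) (use dom in simp_all)
  then show ?thesis using assms(2) by (simp add: square_integrable_def)
qed

lemma square_integrable_add:
  assumes "square_integrable f" and "square_integrable g"
  shows "square_integrable (\<lambda>z. f z + g z)"
proof -
  have [measurable]: "f \<in> borel_measurable circle_measure" "g \<in> borel_measurable circle_measure"
    using assms by (auto simp: square_integrable_def)
  have bound: "(norm (f z + g z))\<^sup>2 \<le> 2 * (norm (f z))\<^sup>2 + 2 * (norm (g z))\<^sup>2" for z
  proof -
    have "(norm (f z + g z))\<^sup>2 \<le> (norm (f z) + norm (g z))\<^sup>2"
      by (intro power_mono norm_triangle_ineq) auto
    also have "\<dots> \<le> 2 * (norm (f z))\<^sup>2 + 2 * (norm (g z))\<^sup>2"
      using zero_le_power2[of "norm (f z) - norm (g z)"] by (simp add: power2_sum power2_diff)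
    finally show ?thesis by simp
  qed
  have "integrable circle_measure (\<lambda>z. 2 * (norm (f z))\<^sup>2 + 2 * (norm (g z))\<^sup>2)"
    using assms by (auto simp: square_integrable_def)
  then have "integrable circle_measure (\<lambda>z. (norm (f z + g z))\<^sup>2)"
    by (rule Bochner_Integration.integrable_bound) (auto intro!: AE_I2 bound)
  then show ?thesis by (simp add: square_integrable_def)
qed

lemma square_integrable_bounded_linear:
  assumes "bounded_linear T" and "square_integrable f"
  shows "square_integrable (\<lambda>z. T (f z))"
proof -
  obtain K where K: "\<And>x. norm (T x) \<le> norm x * K"
    using bounded_linear.bounded[OF assms(1)] by blast
  have "(\<lambda>z. T (f z)) \<in> borel_measurable circle_measure"
    using assms(2) by (intro measurable_bounded_linear[OF assms(1)]) (simp add: square_integrable_def)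
  moreover have "AE z in circle_measure. norm (T (f z)) \<le> K * norm (f z)"
    using K by (intro AE_I2) (simp add: mult.commute)
  ultimately show ?thesis
    by (rule square_integrable_bound[OF assms(2)])
qed

lemma square_integrable_scaleC: "square_integrable f \<Longrightarrow> square_integrable (\<lambda>z. a *\<^sub>C f z)"
  by (rule square_integrable_bounded_linear[OF bounded_linear_scaleC])

lemma square_integrable_scaleR: "square_integrable f \<Longrightarrow> square_integrable (\<lambda>z. a *\<^sub>R f z)"
  by (rule square_integrable_bounded_linear[OF bounded_linear_scaleR_right])

lemma square_integrable_minus: "square_integrable f \<Longrightarrow> square_integrable (\<lambda>z. - f z)"
  using square_integrable_scaleR[of f "-1"] by simp

lemma square_integrable_diff:
  "square_integrable f \<Longrightarrow> square_integrable g \<Longrightarrow> square_integrable (\<lambda>z. f z - g z)"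
  using square_integrable_add[OF _ square_integrable_minus, of f g] by simp

lemma square_integrable_zero: "square_integrable (\<lambda>z. 0)"
  by (simp add: square_integrable_def)

lemma measurable_cinner:
  fixes f g :: "'b \<Rightarrow> 'a::{chilbert_space,second_countable_topology}"
  assumes [measurable]: "f \<in> borel_measurable M" "g \<in> borel_measurable M"
  shows "(\<lambda>z. cinner (f z) (g z)) \<in> borel_measurable M"
proof -
  have [measurable]: "(\<lambda>z. \<i> *\<^sub>C g z) \<in> borel_measurable M"
    by (rule measurable_bounded_linear[OF bounded_linear_scaleC]) fact
  show ?thesis
    by (rule borel_measurable_complex_iff[THEN iffD2]) (simp add: cinner_eq_Complex)
qed

lemma integrable_cinner:
  assumes "square_integrable f" and "square_integrable g"
  shows "integrable circle_measure (\<lambda>z. cinner (f z) (g z))"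
proof (rule Bochner_Integration.integrable_bound[where f="\<lambda>z. (norm (f z))\<^sup>2 + (norm (g z))\<^sup>2"])
  show "AE z in circle_measure. norm (cinner (f z) (g z)) \<le> norm ((norm (f z))\<^sup>2 + (norm (g z))\<^sup>2)"
  proof (rule AE_I2)
    fix z
    have "2 * (norm (f z) * norm (g z)) \<le> (norm (f z))\<^sup>2 + (norm (g z))\<^sup>2"
      using zero_le_power2[of "norm (f z) - norm (g z)"] by (simp add: power2_diff)
    with norm_cinner_le[of "f z" "g z"]
    show "norm (cinner (f z) (g z)) \<le> norm ((norm (f z))\<^sup>2 + (norm (g z))\<^sup>2)" by simp
  qed
qed (use assms in \<open>auto simp: square_integrable_def intro: measurable_cinner\<close>)

definition L2_eq ::
    "(complex \<Rightarrow> 'a::{chilbert_space,second_countable_topology}) \<Rightarrow> (complex \<Rightarrow> 'a) \<Rightarrow> bool"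
  where "L2_eq f g \<longleftrightarrow>
    square_integrable f \<and> square_integrable g \<and> (AE z in circle_measure. f z = g z)"

lemma L2_eq_AE: "L2_eq f g \<Longrightarrow> AE z in circle_measure. f z = g z"
  by (simp add: L2_eq_def)

lemma L2_eq_trans:
  assumes "L2_eq f g" and "L2_eq g h"
  shows "L2_eq f h"
proof -
  have "AE z in circle_measure. f z = h z"
    using L2_eq_AE[OF assms(1)] L2_eq_AE[OF assms(2)] by eventually_elim simp
  then show ?thesis using assms by (simp add: L2_eq_def)
qed

lemma L2_eq_add:
  assumes "L2_eq f f'" and "L2_eq g g'"
  shows "L2_eq (\<lambda>z. f z + g z) (\<lambda>z. f' z + g' z)"
proof -
  have "AE z in circle_measure. f z + g z = f' z + g' z"
    using L2_eq_AE[OF assms(1)] L2_eq_AE[OF assms(2)] by eventually_elim simp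
  then show ?thesis using assms by (simp add: L2_eq_def square_integrable_add)
qed

lemma L2_eq_diff:
  assumes "L2_eq f f'" and "L2_eq g g'"
  shows "L2_eq (\<lambda>z. f z - g z) (\<lambda>z. f' z - g' z)"
proof -
  have "AE z in circle_measure. f z - g z = f' z - g' z"
    using L2_eq_AE[OF assms(1)] L2_eq_AE[OF assms(2)] by eventually_elim simp
  then show ?thesis using assms by (simp add: L2_eq_def square_integrable_diff)
qed

lemma L2_eq_cinner:
  assumes "L2_eq f f'" and "L2_eq g g'"
  shows "(\<integral>z. cinner (f z) (g z) \<partial>circle_measure) = (\<integral>z. cinner (f' z) (g' z) \<partial>circle_measure)"
proof (rule integral_cong_AE)
  show "AE z in circle_measure. cinner (f z) (g z) = cinner (f' z) (g' z)"
    using L2_eq_AE[OF assms(1)] L2_eq_AE[OF assms(2)] by eventually_elim simp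
qed (use assms in \<open>simp_all add: L2_eq_def square_integrable_def measurable_cinner\<close>)

quotient_type (overloaded) 'a circle_L2 =
  "complex \<Rightarrow> 'a::{chilbert_space,second_countable_topology}" / partial: L2_eq
  morphisms rep_L2 abs_L2
proof (rule part_equivpI)
  show "\<exists>f::complex \<Rightarrow> 'a. L2_eq f f"
    by (intro exI[of _ "\<lambda>_. 0"]) (simp add: L2_eq_def square_integrable_zero)
  show "symp (L2_eq :: (complex \<Rightarrow> 'a) \<Rightarrow> _)"
    by (auto simp: L2_eq_def symp_def eq_commute)
  show "transp (L2_eq :: (complex \<Rightarrow> 'a) \<Rightarrow> _)"
    by (rule transpI) (rule L2_eq_trans)
qed

lemma square_integrable_rep_L2: "square_integrable (rep_L2 f)"
  using Quotient_rep_reflp[OF Quotient_circle_L2] by (auto simp: L2_eq_def)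

lemma rep_abs_L2:
  "square_integrable f \<Longrightarrow> AE z in circle_measure. rep_L2 (abs_L2 f) z = f z"
  using rep_abs_rsp[OF Quotient3_circle_L2, of f f] by (auto simp: L2_eq_def)

lemma abs_rep_L2 [simp]: "abs_L2 (rep_L2 f) = f"
  by (rule Quotient_abs_rep[OF Quotient_circle_L2])

lemma L2_eqI: "AE z in circle_measure. rep_L2 f z = rep_L2 g z \<Longrightarrow> f = g"
  using Quotient_rel_rep[OF Quotient_circle_L2, of f g]
  by (simp add: L2_eq_def square_integrable_rep_L2)

instantiation circle_L2 :: ("{chilbert_space,second_countable_topology}") complex_inner
begin

lift_definition zero_circle_L2 :: "'a circle_L2" is "\<lambda>z. 0"
  by (simp add: L2_eq_def square_integrable_zero)

lift_definition plus_circle_L2 :: "'a circle_L2 \<Rightarrow> 'a circle_L2 \<Rightarrow> 'a circle_L2"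
  is "\<lambda>f g z. f z + g z"
  by (rule L2_eq_add)

lift_definition uminus_circle_L2 :: "'a circle_L2 \<Rightarrow> 'a circle_L2" is "\<lambda>f z. - f z"
  unfolding L2_eq_def by (auto intro: square_integrable_minus elim!: eventually_mono)

lift_definition minus_circle_L2 :: "'a circle_L2 \<Rightarrow> 'a circle_L2 \<Rightarrow> 'a circle_L2"
  is "\<lambda>f g z. f z - g z"
  by (rule L2_eq_diff)

lift_definition scaleR_circle_L2 :: "real \<Rightarrow> 'a circle_L2 \<Rightarrow> 'a circle_L2" is "\<lambda>a f z. a *\<^sub>R f z"
  unfolding L2_eq_def by (auto intro: square_integrable_scaleR elim!: eventually_mono)

lift_definition scaleC_circle_L2 :: "complex \<Rightarrow> 'a circle_L2 \<Rightarrow> 'a circle_L2" is "\<lambda>a f z. a *\<^sub>C f z"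
  unfolding L2_eq_def by (auto intro: square_integrable_scaleC elim!: eventually_mono)

lift_definition cinner_circle_L2 :: "'a circle_L2 \<Rightarrow> 'a circle_L2 \<Rightarrow> complex"
  is "\<lambda>f g. \<integral>z. cinner (f z) (g z) \<partial>circle_measure"
  by (rule L2_eq_cinner)

definition inner_circle_L2 :: "'a circle_L2 \<Rightarrow> 'a circle_L2 \<Rightarrow> real"
  where "inner_circle_L2 f g = Re (cinner f g)"

definition norm_circle_L2 :: "'a circle_L2 \<Rightarrow> real"
  where "norm_circle_L2 f = sqrt (inner f f)"

definition sgn_circle_L2 :: "'a circle_L2 \<Rightarrow> 'a circle_L2"
  where "sgn_circle_L2 f = inverse (norm f) *\<^sub>R f"

definition dist_circle_L2 :: "'a circle_L2 \<Rightarrow> 'a circle_L2 \<Rightarrow> real"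
  where "dist_circle_L2 f g = norm (f - g)"

definition uniformity_circle_L2 :: "('a circle_L2 \<times> 'a circle_L2) filter"
  where "uniformity_circle_L2 = (INF e\<in>{0 <..}. principal {(x, y). dist x y < e})"

definition open_circle_L2 :: "'a circle_L2 set \<Rightarrow> bool"
  where "open_circle_L2 S = (\<forall>x\<in>S. \<forall>\<^sub>F (x', y) in uniformity. x' = x \<longrightarrow> y \<in> S)"

instance
proof
  fix f g h :: "'a circle_L2" and a b :: complex and r s :: real
  show "f + g + h = f + (g + h)" "f + g = g + f" "0 + f = f" "- f + f = 0" "f - g = f + - g"
    by (transfer; simp add: L2_eq_def square_integrable_add square_integrable_minus
        square_integrable_diff square_integrable_zero add_ac)+
  show "r *\<^sub>R (f + g) = r *\<^sub>R f + r *\<^sub>R g" "(r + s) *\<^sub>R f = r *\<^sub>R f + s *\<^sub>R f"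
    "r *\<^sub>R s *\<^sub>R f = (r * s) *\<^sub>R f" "1 *\<^sub>R f = f"
    by (transfer; simp add: L2_eq_def square_integrable_add square_integrable_scaleR
        algebra_simps)+
  show "a *\<^sub>C (f + g) = a *\<^sub>C f + a *\<^sub>C g" "(a + b) *\<^sub>C f = a *\<^sub>C f + b *\<^sub>C f"
    "a *\<^sub>C b *\<^sub>C f = (a * b) *\<^sub>C f" "complex_of_real r *\<^sub>C f = r *\<^sub>R f"
    by (transfer; simp add: L2_eq_def square_integrable_add square_integrable_scaleC
        square_integrable_scaleR scaleC_add_right scaleC_add_left scaleC_scaleC scaleC_of_real)+
  show cc: "cinner f g = cnj (cinner g f)" for f g :: "'a circle_L2"
    by transfer (subst Bochner_Integration.integral_cnj[symmetric], rule Bochner_Integration.integral_cong[OF refl],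
        rule cinner_commute)
  show ca: "cinner (f + g) h = cinner f h + cinner g h"
    by transfer (simp add: cinner_add_left integrable_cinner L2_eq_def)
  show cs: "cinner (a *\<^sub>C f) g = a * cinner f g" for a and f g :: "'a circle_L2"
    by transfer (simp add: cinner_scaleC_left)
  show "Re (cinner f g) = inner f g"
    by (simp add: inner_circle_L2_def)
  show "inner f g = inner g f"
    by (simp add: inner_circle_L2_def cc[of f g])
  show "inner (f + g) h = inner f h + inner g h"
    by (simp add: inner_circle_L2_def ca)
  have "r *\<^sub>R f = complex_of_real r *\<^sub>C f"
    by transfer (simp add: L2_eq_def square_integrable_scaleR scaleC_of_real)
  then show "inner (r *\<^sub>R f) g = r * inner f g"
    by (simp add: inner_circle_L2_def cs)
  have sq: "inner f f = (\<integral>z. (norm (rep_L2 f z))\<^sup>2 \<partial>circle_measure)"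
    by (simp add: inner_circle_L2_def cinner_circle_L2.rep_eq cinner_self del: of_real_power)
  then show "0 \<le> inner f f" by simp
  show "inner f f = 0 \<longleftrightarrow> f = 0"
  proof
    assume "inner f f = 0"
    then have "AE z in circle_measure. (norm (rep_L2 f z))\<^sup>2 = 0"
      using integral_nonneg_eq_0_iff_AE[of circle_measure "\<lambda>z. (norm (rep_L2 f z))\<^sup>2"]
        square_integrable_rep_L2[of f] sq by (simp add: square_integrable_def)
    then have "L2_eq (rep_L2 f) (\<lambda>z. 0)"
      by (simp add: L2_eq_def square_integrable_rep_L2 square_integrable_zero)
    from Quotient_rel_abs[OF Quotient_circle_L2, OF this] show "f = 0"
      by (simp add: zero_circle_L2_def)
  next
    have "cinner (0::'a circle_L2) 0 = 0"
      by transfer (simp add: cinner_self)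
    moreover assume "f = 0"
    ultimately show "inner f f = 0"
      by (simp add: inner_circle_L2_def)
  qed
qed (simp_all add: norm_circle_L2_def sgn_circle_L2_def dist_circle_L2_def
    uniformity_circle_L2_def open_circle_L2_def)

end

lemma power2_norm_L2:
  assumes "square_integrable f"
  shows "(norm (abs_L2 f))\<^sup>2 = (\<integral>z. (norm (f z))\<^sup>2 \<partial>circle_measure)"
proof -
  have "complex_of_real ((norm (abs_L2 f))\<^sup>2) = (\<integral>z. cinner (f z) (f z) \<partial>circle_measure)"
    using assms by (simp only: flip: cinner_self) (simp add: cinner_circle_L2.abs_eq L2_eq_def)
  also have "\<dots> = complex_of_real (\<integral>z. (norm (f z))\<^sup>2 \<partial>circle_measure)"
    by (simp only: cinner_self integral_complex_of_real)
  finally show ?thesis by (simp only: of_real_eq_iff)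
qed

lemma diff_abs_L2:
  "square_integrable f \<Longrightarrow> square_integrable g \<Longrightarrow> abs_L2 f - abs_L2 g = abs_L2 (\<lambda>z. f z - g z)"
  by (simp add: minus_circle_L2.abs_eq L2_eq_def)

lemma nn_integral_norm_L2:
  assumes "square_integrable f"
  shows "(\<integral>\<^sup>+z. ennreal ((norm (f z))\<^sup>2) \<partial>circle_measure) = ennreal ((norm (abs_L2 f))\<^sup>2)"
  using assms by (simp add: power2_norm_L2 nn_integral_eq_integral square_integrable_def)

lemma L2_rapidly_Cauchy_converges:
  fixes f :: "nat \<Rightarrow> complex \<Rightarrow> 'a::{chilbert_space,second_countable_topology}"
  assumes f: "\<And>n. square_integrable (f n)"
    and rapid: "\<And>n m. m \<ge> n \<Longrightarrow> norm (abs_L2 (f m) - abs_L2 (f n)) \<le> (1/2)^n"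
  shows "\<exists>g. (\<lambda>n. abs_L2 (f n)) \<longlonglongrightarrow> g"
proof -
  have [measurable]: "f n \<in> borel_measurable circle_measure" for n
    using f by (simp add: square_integrable_def)
  have diff: "square_integrable (\<lambda>z. f m z - f n z)" for m n
    by (rule square_integrable_diff[OF f f])
  have rapid2: "(\<integral>\<^sup>+z. ennreal ((norm (f m z - f n z))\<^sup>2) \<partial>circle_measure) \<le> ennreal ((1/4)^n)"
    if "m \<ge> n" for m n
  proof -
    have "(norm (abs_L2 (f m) - abs_L2 (f n)))\<^sup>2 \<le> ((1/2)^n)\<^sup>2"
      by (intro power_mono rapid that) simp
    also have "((1/2)^n)\<^sup>2 = (1/4::real)^n"
      by (simp add: power2_eq_square flip: power_mult_distrib)
    finally show ?thesis
      by (simp add: nn_integral_norm_L2[OF diff] diff_abs_L2[OF f f] ennreal_leI)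
  qed
  define d where "d n z = norm (f (Suc n) z - f n z)" for n z
  have [measurable]: "d n \<in> borel_measurable circle_measure" for n
    unfolding d_def by measurable
  have d_bound: "ennreal (d n z) \<le> ennreal (2^n) * ennreal ((d n z)\<^sup>2) + ennreal ((1/2)^n)" for n z
  proof -
    have "0 \<le> (2^n * d n z - 1)\<^sup>2 / 2^n" by simp
    also have "\<dots> = 2^n * (d n z)\<^sup>2 - 2 * d n z + (1/2)^n"
      by (simp add: power2_eq_square field_simps)
    finally have "2 * d n z \<le> 2^n * (d n z)\<^sup>2 + (1/2)^n" by simp
    moreover have "0 \<le> d n z" by (simp add: d_def)
    ultimately have "d n z \<le> 2^n * (d n z)\<^sup>2 + (1/2)^n" by linarith
    then show ?thesis
      by (simp add: ennreal_leI flip: ennreal_mult ennreal_plus)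
  qed
  have "(\<integral>\<^sup>+z. ennreal (d n z) \<partial>circle_measure) \<le> ennreal (2 * (1/2)^n)" for n
  proof -
    have "(\<integral>\<^sup>+z. ennreal (d n z) \<partial>circle_measure)
        \<le> (\<integral>\<^sup>+z. ennreal (2^n) * ennreal ((d n z)\<^sup>2) + ennreal ((1/2)^n) \<partial>circle_measure)"
      by (intro nn_integral_mono d_bound)
    also have "\<dots> = ennreal (2^n) * (\<integral>\<^sup>+z. ennreal ((d n z)\<^sup>2) \<partial>circle_measure) + ennreal ((1/2)^n)"
      by (subst nn_integral_add) (simp_all add: nn_integral_cmult circle.emeasure_space_1[simplified])
    also have "\<dots> \<le> ennreal (2^n) * ennreal ((1/4)^n) + ennreal ((1/2)^n)"
      using rapid2[of n "Suc n"] by (intro add_mono mult_left_mono) (auto simp: d_def)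
    also have "\<dots> = ennreal (2 * (1/2)^n)"
      by (simp flip: ennreal_mult ennreal_plus power_mult_distrib)
    finally show ?thesis .
  qed
  then have "(\<integral>\<^sup>+z. (\<Sum>n. ennreal (d n z)) \<partial>circle_measure) \<le> (\<Sum>n. ennreal (2 * (1/2)^n))"
    by (subst nn_integral_suminf) (auto intro!: suminf_le)
  also have "\<dots> = ennreal (\<Sum>n. 2 * (1/2)^n)"
    by (intro suminf_ennreal2 summable_mult summable_geometric) auto
  also have "\<dots> < \<infinity>" by simp
  finally have "AE z in circle_measure. (\<Sum>n. ennreal (d n z)) \<noteq> \<infinity>"
    by (intro nn_integral_PInf_AE) auto
  then have conv: "AE z in circle_measure. convergent (\<lambda>n. f n z)"
  proof eventually_elim
    fix z assume "(\<Sum>n. ennreal (d n z)) \<noteq> \<infinity>"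
    then have "summable (\<lambda>n. d n z)"
      by (intro summable_suminf_not_top) (auto simp: d_def)
    then have "summable (\<lambda>n. norm (f (Suc n) z - f n z))"
      by (simp add: d_def)
    then have "summable (\<lambda>n. f (Suc n) z - f n z)"
      by (rule summable_norm_cancel)
    then have "convergent (\<lambda>n. f n z - f 0 z)"
      by (simp add: summable_iff_convergent sum_lessThan_telescope[of "\<lambda>n. f n z"])
    from convergent_add[OF this convergent_const[of "f 0 z"]]
    show "convergent (\<lambda>n. f n z)" by simp
  qed
  define g where "g z = lim (\<lambda>n. f n z)" for z
  have [measurable]: "g \<in> borel_measurable circle_measure"
    unfolding g_def by (rule borel_measurable_lim_metric) measurable
  have lim: "AE z in circle_measure. (\<lambda>n. f n z) \<longlonglongrightarrow> g z"
    using conv by eventually_elim (simp add: g_def convergent_LIMSEQ_iff)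
  have bound: "(\<integral>\<^sup>+z. ennreal ((norm (g z - f n z))\<^sup>2) \<partial>circle_measure) \<le> ennreal ((1/4)^n)" for n
  proof -
    have "AE z in circle_measure.
        ennreal ((norm (g z - f n z))\<^sup>2) = liminf (\<lambda>m. ennreal ((norm (f m z - f n z))\<^sup>2))"
      using lim
    proof eventually_elim
      fix z assume "(\<lambda>m. f m z) \<longlonglongrightarrow> g z"
      then have "(\<lambda>m. ennreal ((norm (f m z - f n z))\<^sup>2)) \<longlonglongrightarrow> ennreal ((norm (g z - f n z))\<^sup>2)"
        by (intro tendsto_ennrealI tendsto_intros)
      then show "ennreal ((norm (g z - f n z))\<^sup>2) = liminf (\<lambda>m. ennreal ((norm (f m z - f n z))\<^sup>2))"
        by (intro lim_imp_Liminf[symmetric]) auto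
    qed
    then have "(\<integral>\<^sup>+z. ennreal ((norm (g z - f n z))\<^sup>2) \<partial>circle_measure)
        = (\<integral>\<^sup>+z. liminf (\<lambda>m. ennreal ((norm (f m z - f n z))\<^sup>2)) \<partial>circle_measure)"
      by (rule nn_integral_cong_AE)
    also have "\<dots> \<le> liminf (\<lambda>m. \<integral>\<^sup>+z. ennreal ((norm (f m z - f n z))\<^sup>2) \<partial>circle_measure)"
      by (intro nn_integral_liminf) auto
    also have "\<dots> \<le> liminf (\<lambda>m. ennreal ((1/4)^n))"
      by (intro Liminf_mono eventually_sequentiallyI[of n] rapid2)
    finally show ?thesis by (simp add: Liminf_const)
  qed
  have gf: "square_integrable (\<lambda>z. g z - f n z)" for n
    using le_less_trans[OF bound[of n]]
    by (simp add: square_integrable_def integrable_iff_bounded)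
  have g: "square_integrable g"
    using square_integrable_add[OF gf[of 0] f[of 0]] by simp
  have dist: "dist (abs_L2 (f n)) (abs_L2 g) \<le> (1/2)^n" for n
  proof -
    have "ennreal ((norm (abs_L2 g - abs_L2 (f n)))\<^sup>2) \<le> ennreal ((1/4)^n)"
      using bound[of n] by (simp add: nn_integral_norm_L2[OF gf] diff_abs_L2[OF g f])
    then have "(norm (abs_L2 g - abs_L2 (f n)))\<^sup>2 \<le> (1/4)^n"
      by (subst (asm) ennreal_le_iff) auto
    also have "(1/4::real)^n = ((1/2)^n)\<^sup>2"
      by (simp add: power2_eq_square flip: power_mult_distrib)
    finally have "norm (abs_L2 g - abs_L2 (f n)) \<le> (1/2)^n"
      by (rule power2_le_imp_le) simp
    then show ?thesis by (simp add: dist_norm norm_minus_commute)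
  qed
  have "(\<lambda>n. dist (abs_L2 (f n)) (abs_L2 g)) \<longlonglongrightarrow> 0"
    by (rule tendsto_sandwich[OF _ _ tendsto_const LIMSEQ_power_zero[of "1/2::real"]])
      (use dist in auto)
  then show ?thesis
    using tendsto_dist_iff by blast
qed

instance circle_L2 :: ("{chilbert_space,second_countable_topology}") chilbert_space
proof
  fix X :: "nat \<Rightarrow> 'a circle_L2"
  assume X: "Cauchy X"
  have "\<exists>N. \<forall>m\<ge>N. \<forall>k\<ge>N. dist (X m) (X k) < (1/2)^n" for n
    using X unfolding Cauchy_def by (meson zero_less_power half_gt_zero_iff zero_less_one)
  then obtain N where N: "\<And>n m k. m \<ge> N n \<Longrightarrow> k \<ge> N n \<Longrightarrow> dist (X m) (X k) < (1/2)^n"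
    by metis
  define r where "r n = (\<Sum>k\<le>n. Suc (N k))" for n
  have r: "strict_mono r"
    by (rule strict_monoI_Suc) (simp add: r_def)
  have rN: "N n \<le> r n" for n
    using member_le_sum[of n "{..n}" "\<lambda>k. Suc (N k)"] by (simp add: r_def)
  have "\<exists>g. (\<lambda>n. abs_L2 (rep_L2 (X (r n)))) \<longlonglongrightarrow> g"
  proof (rule L2_rapidly_Cauchy_converges)
    fix n m :: nat assume "n \<le> m"
    then have "N n \<le> r m"
      using rN[of n] strict_mono_leD[OF r, of n m] by linarith
    then show "norm (abs_L2 (rep_L2 (X (r m))) - abs_L2 (rep_L2 (X (r n)))) \<le> (1/2)^n"
      using N[OF _ rN, of n "r m"] by (simp add: dist_norm)
  qed (rule square_integrable_rep_L2)
  then obtain g where "(X \<circ> r) \<longlonglongrightarrow> g"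
    by (auto simp: comp_def)
  then have "X \<longlonglongrightarrow> g"
    by (rule Cauchy_converges_subseq[OF X r])
  then show "convergent X"
    by (auto simp: convergent_def)
qed


section \<open>Operators on $L^2(\mathcal{H})$\<close>

text \<open>
  \<open>Linf_op\<close> consists of the representatives of the elements of $L^\infty(L(\mathcal{H}))$;
  measurability is that of \<open>z \<mapsto> F z x\<close> for each vector \<open>x\<close>.
\<close>

definition Linf_op :: "(complex \<Rightarrow> 'a \<Rightarrow> 'a::{chilbert_space,second_countable_topology}) set"
  where "Linf_op = {F.
    (\<forall>z\<in>sphere 0 1. bounded_clinear (F z)) \<and>
    (\<forall>x. (\<lambda>z. F z x) \<in> borel_measurable circle_measure) \<and>
    (\<exists>B. AE z in circle_measure. onorm (F z) \<le> B)}"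

definition mult_op ::
    "(complex \<Rightarrow> 'a \<Rightarrow> 'a::{chilbert_space,second_countable_topology}) \<Rightarrow> 'a circle_L2 \<Rightarrow> 'a circle_L2"
  where "mult_op F f = abs_L2 (\<lambda>z. F z (rep_L2 f z))"

definition shift_op :: "'a::{chilbert_space,second_countable_topology} circle_L2 \<Rightarrow> 'a circle_L2"
  where "shift_op f = abs_L2 (\<lambda>z. z *\<^sub>C rep_L2 f z)"

definition conj_star ::
    "('a \<Rightarrow> 'a::{chilbert_space,second_countable_topology}) \<Rightarrow> 'a circle_L2 \<Rightarrow> 'a circle_L2"
  where "conj_star J f = abs_L2 (\<lambda>z. J (rep_L2 f (cnj z)))"

text \<open>
  \<^const>\<open>abs_L2\<close> is meaningful only on square integrable functions.  The lemmas \<open>rep_mult_op\<close>,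
  \<open>rep_shift_op\<close> and \<open>rep_conj_star\<close> below confirm that the three operators satisfy their defining
  equations almost everywhere.
\<close>

lemma square_integrable_mult:
  assumes F: "F \<in> Linf_op" and f: "square_integrable f"
  shows "square_integrable (\<lambda>z. F z (f z))"
proof -
  from F obtain B where lin: "\<And>z. z \<in> sphere 0 1 \<Longrightarrow> bounded_linear (F z)"
    and meas: "\<And>x. (\<lambda>z. F z x) \<in> borel_measurable circle_measure"
    and B: "AE z in circle_measure. onorm (F z) \<le> B"
    by (auto simp: Linf_op_def bounded_clinear_def)
  from f have "f \<in> borel_measurable circle_measure"
    by (simp add: square_integrable_def)
  then obtain s where s: "\<forall>i. simple_function circle_measure (s i)"
    and lim: "\<forall>z\<in>space circle_measure. (\<lambda>i. s i z) \<longlonglongrightarrow> f z"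
    using borel_measurable_implies_sequence_metric by blast
  have "(\<lambda>z. F z (s i z)) \<in> borel_measurable circle_measure" for i
  proof (rule measurable_compose_countable'[where f="\<lambda>x z. F z x" and I="s i ` space circle_measure"])
    show "s i \<in> circle_measure \<rightarrow>\<^sub>M count_space (s i ` space circle_measure)"
      using simple_functionD[OF s[rule_format, of i]]
      by (subst measurable_count_space_eq2) (simp_all del: space_circle_measure)
    show "countable (s i ` space circle_measure)"
      using s simple_functionD(1) countable_finite by blast
  qed (rule meas)
  then have "(\<lambda>z. F z (f z)) \<in> borel_measurable circle_measure"
    by (rule borel_measurable_LIMSEQ_metric)
      (use lim in \<open>auto intro!: bounded_linear.tendsto[OF lin]\<close>)
  moreover have "AE z in circle_measure. norm (F z (f z)) \<le> B * norm (f z)"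
    using B AE_space
  proof eventually_elim
    fix z assume "onorm (F z) \<le> B" "z \<in> space circle_measure"
    then show "norm (F z (f z)) \<le> B * norm (f z)"
      using onorm[OF lin, of z "f z"] mult_right_mono[of "onorm (F z)" B "norm (f z)"] by simp
  qed
  ultimately show ?thesis
    by (rule square_integrable_bound[OF f])
qed

lemma rep_mult_op:
  "F \<in> Linf_op \<Longrightarrow> AE z in circle_measure. rep_L2 (mult_op F f) z = F z (rep_L2 f z)"
  unfolding mult_op_def by (rule rep_abs_L2[OF square_integrable_mult[OF _ square_integrable_rep_L2]])

lemma scaleC_id_in_Linf_op: "(\<lambda>z x. z *\<^sub>C x) \<in> Linf_op"
proof -
  have "(\<lambda>z. z *\<^sub>C x) \<in> borel_measurable circle_measure" for x :: 'a
  proof -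
    have [measurable]: "(\<lambda>z. z) \<in> borel_measurable circle_measure"
      by (rule measurable_circle_id)
    have "(\<lambda>z. Re z *\<^sub>R x + Im z *\<^sub>R \<i> *\<^sub>C x) \<in> borel_measurable circle_measure"
      by measurable
    then show ?thesis by (simp only: scaleC_decomp[of _ x, symmetric])
  qed
  moreover have "AE z in circle_measure. onorm (\<lambda>x::'a. z *\<^sub>C x) \<le> 1"
    by (intro AE_I2 onorm_bound) (auto simp: norm_scaleC)
  ultimately show ?thesis
    by (auto simp: Linf_op_def bounded_clinear_def bounded_linear_scaleC scaleC_scaleC mult.commute)
qed

lemma rep_shift_op: "AE z in circle_measure. rep_L2 (shift_op f) z = z *\<^sub>C rep_L2 f z"
  using rep_mult_op[OF scaleC_id_in_Linf_op, of f] by (simp add: shift_op_def mult_op_def)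

lemma measurable_cnj_circle_borel: "cnj \<in> circle_borel \<rightarrow>\<^sub>M circle_borel"
proof -
  have "cnj \<in> restrict_space borel (sphere 0 1) \<rightarrow>\<^sub>M restrict_space borel (sphere 0 1)"
    by (intro measurable_restrict_space3 borel_measurable_continuous_onI continuous_intros) auto
  then show ?thesis
    unfolding circle_borel_def by simp
qed

lemma distr_cnj_circle_borel: "distr circle_borel circle_borel cnj = circle_borel"
proof (rule measure_eqI)
  let ?e = "\<lambda>t::real. cis (2 * pi * t)"
  fix A assume A: "A \<in> sets (distr circle_borel circle_borel cnj)"
  then have A': "A \<in> sets (restrict_space borel (sphere 0 1))" and A'': "A \<in> sets circle_borel"
    by (simp_all add: circle_borel_def)
  then have [measurable]: "A \<in> sets borel"
    by (simp add: sets_restrict_space_iff)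
  have [measurable]: "?e \<in> borel_measurable borel"
    by (intro borel_measurable_continuous_onI continuous_intros)
  have [measurable]: "cnj \<in> borel_measurable borel"
    by (intro borel_measurable_continuous_onI continuous_intros)
  have B: "emeasure circle_borel A' = emeasure lborel {t. 0 \<le> t \<and> t < 1 \<and> ?e t \<in> A'}"
    if "A' \<in> sets (restrict_space borel (sphere 0 1))" for A'
  proof -
    from that have [measurable]: "A' \<in> sets borel"
      by (simp add: sets_restrict_space_iff)
    have "emeasure circle_borel A' = emeasure (uniform_measure lborel {0..<1}) (?e -` A')"
      using that unfolding circle_borel_def
      by (subst emeasure_distr[OF measurable_cis_circle]) auto
    also have "\<dots> = emeasure lborel ({0..<1} \<inter> ?e -` A')"
      using measurable_sets_borel[of ?e borel A'] by (simp add: divide_ennreal_def)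
    also have "{0..<1} \<inter> ?e -` A' = {t. 0 \<le> t \<and> t < 1 \<and> ?e t \<in> A'}"
      by auto
    finally show ?thesis .
  qed
  have cnjA: "cnj -` A \<inter> space circle_borel \<in> sets (restrict_space borel (sphere 0 1))"
    using measurable_sets[OF measurable_cnj_circle_borel A''] by (simp add: circle_borel_def)
  have "emeasure (distr circle_borel circle_borel cnj) A = emeasure circle_borel (cnj -` A \<inter> space circle_borel)"
    by (rule emeasure_distr[OF measurable_cnj_circle_borel A''])
  also have "\<dots> = emeasure lborel {t. 0 \<le> t \<and> t < 1 \<and> ?e t \<in> cnj -` A \<inter> space circle_borel}"
    by (rule B[OF cnjA])
  also have "\<dots> = emeasure lborel {t. 0 \<le> t \<and> t < 1 \<and> cnj (?e t) \<in> A}"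
    by (simp add: circle_borel_def space_restrict_space)
  also have "\<dots> = (\<integral>\<^sup>+t. indicator {t. 0 \<le> t \<and> t < 1 \<and> cnj (?e t) \<in> A} t \<partial>lborel)"
    by (rule nn_integral_indicator[symmetric]) measurable
  also have "\<dots> = (\<integral>\<^sup>+t. indicator {t. 0 \<le> t \<and> t < 1 \<and> ?e t \<in> A} (1 + (-1) * t) \<partial>lborel)"
  proof (rule nn_integral_cong_AE)
    have e: "?e (1 + (-1) * t) = cnj (?e t)" for t
    proof -
      have "?e (1 + (-1) * t) = cis (2 * pi + - (2 * pi * t))"
        by (rule arg_cong[where f=cis]) (simp add: algebra_simps)
      also have "\<dots> = cnj (?e t)"
        by (simp only: cis_mult[symmetric] cis_cnj) simp
      finally show ?thesis .
    qed
    show "AE t in lborel. indicator {t. 0 \<le> t \<and> t < 1 \<and> cnj (?e t) \<in> A} t =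
        (indicator {t. 0 \<le> t \<and> t < 1 \<and> ?e t \<in> A} (1 + (-1) * t) :: ennreal)"
      using AE_lborel_singleton[of 0] AE_lborel_singleton[of 1]
      by eventually_elim (simp only: indicator_def mem_Collect_eq e, auto)
  qed
  also have "\<dots> = (\<integral>\<^sup>+t. indicator {t. 0 \<le> t \<and> t < 1 \<and> ?e t \<in> A} t \<partial>lborel)"
    by (subst nn_integral_real_affine[where c="-1" and t=1, of "indicator _"]) simp_all
  also have "\<dots> = emeasure lborel {t. 0 \<le> t \<and> t < 1 \<and> ?e t \<in> A}"
    by (rule nn_integral_indicator) measurable
  also have "\<dots> = emeasure circle_borel A"
    by (rule B[OF A', symmetric])
  finally show "emeasure (distr circle_borel circle_borel cnj) A = emeasure circle_borel A" .
qed simp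

lemma measurable_cnj_circle: "cnj \<in> circle_measure \<rightarrow>\<^sub>M circle_measure"
  and distr_cnj_circle: "distr circle_measure circle_measure cnj = circle_measure"
proof -
  have meas: "cnj \<in> circle_measure \<rightarrow>\<^sub>M circle_borel"
    unfolding circle_measure_def by (intro measurable_completion measurable_cnj_circle_borel)
  have distr: "distr circle_measure circle_borel cnj = circle_borel"
    unfolding circle_measure_def
    by (simp add: distr_completion measurable_cnj_circle_borel distr_cnj_circle_borel)
  show "cnj \<in> circle_measure \<rightarrow>\<^sub>M circle_measure"
    using circle.measurable_completion2[OF meas] by (simp add: distr flip: circle_measure_def)
  show "distr circle_measure circle_measure cnj = circle_measure"
    using circle.completion_distr_eq[OF meas] by (simp add: distr flip: circle_measure_def)
qed

lemma conjugation_norm: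
  assumes "conjugation C"
  shows "norm (C x) = norm x"
proof -
  have "complex_of_real ((norm (C x))\<^sup>2) = complex_of_real ((norm x)\<^sup>2)"
    using assms by (simp only: conjugation_def flip: cinner_self)
  then show ?thesis
    by (simp only: of_real_eq_iff) (simp add: power2_eq_iff_nonneg)
qed

lemma conjugation_bounded_linear:
  assumes "conjugation C"
  shows "bounded_linear C"
proof (rule bounded_linear_intro[where K=1])
  show "C (r *\<^sub>R x) = r *\<^sub>R C x" for r x
    using assms by (metis complex_cnj_complex_of_real conjugation_def scaleC_of_real)
qed (use assms in \<open>simp_all add: conjugation_norm, simp add: conjugation_def\<close>)

lemma square_integrable_conj_star:
  assumes J: "conjugation J" and f: "square_integrable f"
  shows "square_integrable (\<lambda>z. J (f (cnj z)))"
proof -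
  have "f \<in> borel_measurable circle_measure"
    and int: "integrable (distr circle_measure circle_measure cnj) (\<lambda>z. (norm (f z))\<^sup>2)"
    using f by (simp_all add: square_integrable_def distr_cnj_circle)
  then have "(\<lambda>z. f (cnj z)) \<in> borel_measurable circle_measure"
    by (intro measurable_compose[OF measurable_cnj_circle])
  moreover have "integrable circle_measure (\<lambda>z. (norm (f (cnj z)))\<^sup>2)"
    by (rule integrable_distr[OF measurable_cnj_circle int])
  ultimately have "square_integrable (\<lambda>z. f (cnj z))"
    by (simp add: square_integrable_def)
  then show ?thesis
    by (rule square_integrable_bounded_linear[OF conjugation_bounded_linear[OF J]])
qed

lemma rep_conj_star:
  "conjugation J \<Longrightarrow> AE z in circle_measure. rep_L2 (conj_star J f) z = J (rep_L2 f (cnj z))"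
  unfolding conj_star_def by (rule rep_abs_L2[OF square_integrable_conj_star[OF _ square_integrable_rep_L2]])

end

theory Submission
  imports Defs
begin

text \<open>
  The substance is that a conjugation \<open>C\<close> commuting with multiplication by \<open>z\<close> differs from
  \<open>J\<^sup>\<star>\<close> by a multiplication operator.  Since \<open>J\<^sup>\<star>\<close> also commutes with the shift (the
  antilinearity of \<open>J\<close> and the reflection of the argument each conjugate \<open>z\<close>, and the two effects
  cancel), \<open>T = C J\<^sup>\<star>\<close> is a unitary operator commuting with the shift.  For such \<open>T\<close> all the moments
  \<open>\<integral> z^m cnj z^n \<langle>T f, T g\<rangle>\<close> equal those of \<open>\<langle>f, g\<rangle>\<close>, because moving the powers of \<open>z\<close> into
  the two arguments turns them into inner products in $L^2(\mathcal{H})$, which \<open>T\<close> preserves.  An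
  integrable function on the circle is determined by its moments (\<open>vanishing_moments_AE_zero\<close>), so
  \<open>\<langle>T f(z), T g(z)\<rangle> = \<langle>f(z), g(z)\<rangle>\<close> almost everywhere (\<open>shift_isometry_pointwise\<close>): \<open>T\<close> preserves
  the inner product not only globally but fibre by fibre.

  Fibrewise, let \<open>u x\<close> be the image under \<open>T\<close> of the constant function \<open>x\<close>.  Off a single null set,
  \<open>x \<mapsto> u x z\<close> preserves inner products on a countable dense set and therefore extends to a linear
  isometry \<open>U z\<close>.  The distance of \<open>T f(z)\<close> from \<open>u x z\<close> is that of \<open>f(z)\<close> from \<open>x\<close>; letting \<open>x\<close>
  tend to \<open>f(z)\<close> gives \<open>T f(z) = U z (f z)\<close> (\<open>shift_isometry_is_mult_op\<close>), without any approximation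
  of \<open>f\<close> in $L^2(\mathcal{H})$.  Surjectivity of \<open>T\<close> puts the dense set into the range of \<open>U z\<close>, which
  is complete, so \<open>U z\<close> is unitary.  The symmetry of \<open>M\<^sub>U = C J\<^sup>\<star>\<close> and the second factorization of
  \<open>C\<close> are then formal, because the adjoint of \<open>C J\<^sup>\<star>\<close> is \<open>J\<^sup>\<star> C\<close>.

  The converse is a pointwise computation.  It rests on the fact that an involution reversing the
  inner product is automatically antilinear (\<open>conjugationI\<close>), and on the existence of adjoints, by
  which a unitary operator preserves the inner product.
\<close>

section \<open>Adjoints\<close>

text \<open>
  The representing vector minimises \<open>\<parallel>x\<parallel>\<^sup>2 - 2 \<phi>(x)\<close>, which is \<open>\<parallel>x - v\<parallel>\<^sup>2 - \<parallel>v\<parallel>\<^sup>2\<close> once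
  \<open>\<phi> = \<langle>_, v\<rangle>\<close> is known.  Completeness provides the minimiser, and the vanishing of the first
  variation there is the asserted identity.
\<close>

lemma riesz_representation:
  fixes \<phi> :: "'a::{real_inner,complete_space} \<Rightarrow> real"
  assumes "bounded_linear \<phi>"
  shows "\<exists>v. \<forall>x. \<phi> x = inner x v"
proof -
  interpret \<phi>: bounded_linear \<phi> by fact
  obtain K where K: "\<And>x. norm (\<phi> x) \<le> norm x * K"
    using \<phi>.bounded by blast
  define F where "F x = (norm x)\<^sup>2 - 2 * \<phi> x" for x
  have lower: "- K\<^sup>2 \<le> F x" for x
  proof -
    have "0 \<le> (norm x - K)\<^sup>2" by simp
    also have "\<dots> = (norm x)\<^sup>2 - 2 * (norm x * K) + K\<^sup>2"
      by (simp add: power2_diff)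
    also have "\<dots> \<le> F x + K\<^sup>2"
      using K[of x] by (simp add: F_def)
    finally show ?thesis by simp
  qed
  define m where "m = (INF x. F x)"
  have bdd: "bdd_below (range F)"
    using lower by (intro bdd_belowI[of _ "- K\<^sup>2"]) auto
  have m_le: "m \<le> F x" for x
    unfolding m_def by (rule cINF_lower[OF bdd]) simp
  define r where "r n = 1 / real (Suc n)" for n
  have "\<exists>x. F x < m + r n" for n
    using cINF_less_iff[OF _ bdd, of "m + r n"] by (simp add: m_def r_def)
  then obtain X where X: "\<And>n. F (X n) < m + r n"
    by metis
  \<comment> \<open>The parallelogram law turns near-minimality of two points into their closeness.\<close>
  have close: "(norm (x - y))\<^sup>2 \<le> 2 * (F x - m) + 2 * (F y - m)" for x y
  proof -
    have "F ((1/2) *\<^sub>R (x + y)) = (1/4) * (norm (x + y))\<^sup>2 - (\<phi> x + \<phi> y)"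
      by (simp add: F_def \<phi>.scaleR \<phi>.add power_divide add_divide_distrib)
    then have "(norm (x - y))\<^sup>2 = 2 * F x + 2 * F y - 4 * F ((1/2) *\<^sub>R (x + y))"
      by (simp add: F_def power2_norm_eq_inner inner_add_left inner_add_right inner_diff_left
          inner_diff_right inner_commute field_simps)
    then show ?thesis using m_le[of "(1/2) *\<^sub>R (x + y)"] by simp
  qed
  have "Cauchy X"
  proof (rule metric_CauchyI)
    fix e :: real assume "0 < e"
    then obtain N where N: "r N < e\<^sup>2 / 4"
      unfolding r_def using nat_approx_posE[of "e\<^sup>2 / 4"] by (metis divide_pos_pos zero_less_numeral zero_less_power)
    show "\<exists>N. \<forall>i\<ge>N. \<forall>j\<ge>N. dist (X i) (X j) < e"
    proof (intro exI allI impI)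
      fix i j assume "N \<le> i" "N \<le> j"
      then have "r i \<le> r N" "r j \<le> r N"
        by (simp_all add: r_def frac_le)
      then have "2 * (F (X i) - m) + 2 * (F (X j) - m) < 4 * r N"
        using X[of i] X[of j] by argo
      also have "\<dots> < e\<^sup>2"
        using N by simp
      finally have "(norm (X i - X j))\<^sup>2 < e\<^sup>2"
        using close[of "X i" "X j"] by (rule le_less_trans[rotated])
      then show "dist (X i) (X j) < e"
        using \<open>0 < e\<close> by (simp add: dist_norm power2_less_imp_less)
    qed
  qed
  then obtain v where v: "X \<longlonglongrightarrow> v"
    using Cauchy_convergent_iff convergent_def by blast
  have "(\<lambda>n. F (X n)) \<longlonglongrightarrow> F v"
    unfolding F_def by (intro tendsto_intros v \<phi>.tendsto)
  moreover have "(\<lambda>n. F (X n)) \<longlonglongrightarrow> m"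
  proof (rule tendsto_sandwich[OF _ _ tendsto_const])
    show "(\<lambda>n. m + r n) \<longlonglongrightarrow> m"
      using tendsto_add[OF tendsto_const LIMSEQ_inverse_real_of_nat, of m] by (simp add: r_def inverse_eq_divide)
  qed (use m_le less_imp_le[OF X] in simp_all)
  ultimately have Fv: "F v = m"
    using LIMSEQ_unique by blast
  have "\<phi> x = inner x v" for x
  proof (rule ccontr)
    define c where "c = \<phi> x - inner x v"
    assume "\<phi> x \<noteq> inner x v"
    then have "x \<noteq> 0" and c: "c \<noteq> 0"
      by (auto simp: c_def)
    then have pos: "0 < inner x x" by simp
    have F: "F (v + t *\<^sub>R x) = F v + t\<^sup>2 * inner x x - 2 * t * c" for t
      by (simp only: F_def c_def power2_norm_eq_inner \<phi>.add \<phi>.scaleR inner_add_left inner_add_right)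
        (simp add: inner_commute power2_eq_square algebra_simps)
    \<comment> \<open>the minimiser in \<open>t\<close> of the quadratic polynomial above\<close>
    have "F (v + (c / inner x x) *\<^sub>R x) = F v - c\<^sup>2 / inner x x"
      using pos by (simp add: F power2_eq_square field_simps)
    also have "\<dots> < m"
      using pos c by (simp add: Fv)
    finally show False using m_le by (simp add: not_less[symmetric])
  qed
  then show ?thesis by blast
qed

lemma cinner_diff_left: "cinner (x - y) z = cinner x z - cinner y z"
  using cinner_add_left[of "x - y" y z] by simp

lemma cinner_diff_right: "cinner x (y - z) = cinner x y - cinner x z"
  using cinner_add_right[of x "y - z" z] by simp

text \<open>
  \<^const>\<open>cadjoint\<close> is a definite description, so its defining equation needs an existence proof.  The
  adjoint for the real inner product is also the complex one: imaginary parts are real inner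
  products with a vector rotated by \<open>\<i>\<close>, and \<open>A\<close> commutes with the rotation.
\<close>

lemma cinner_cadjoint:
  fixes A :: "'a::chilbert_space \<Rightarrow> 'a"
  assumes "bounded_clinear A"
  shows "cinner (A x) y = cinner x (cadjoint A y)"
proof -
  have lin: "bounded_linear A" and A: "\<And>a x. A (a *\<^sub>C x) = a *\<^sub>C A x"
    using assms by (auto simp: bounded_clinear_def)
  have "\<exists>w. \<forall>x. inner (A x) y = inner x w" for y
    using riesz_representation[OF bounded_linear_compose[OF bounded_linear_inner_left lin], of y]
    by simp
  then obtain B where B: "\<And>x y. inner (A x) y = inner x (B y)"
    by metis
  have swap: "inner u (\<i> *\<^sub>C v) = - inner (\<i> *\<^sub>C u) v" for u v :: 'a
    by (simp add: cinner_scaleC_left cinner_scaleC_right flip: Re_cinner)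
  have "cinner (A x) y = cinner x (B y)" for x y
    by (simp add: cinner_eq_Complex swap B flip: A)
  then show ?thesis
    using cadjoint_eqI[of A B] by simp
qed

section \<open>Maps preserving the inner product\<close>

definition cinner_preserving :: "('a::complex_inner \<Rightarrow> 'b::complex_inner) \<Rightarrow> bool"
  where "cinner_preserving U \<longleftrightarrow> (\<forall>x y. cinner (U x) (U y) = cinner x y)"

lemma cinner_preservingD: "cinner_preserving U \<Longrightarrow> cinner (U x) (U y) = cinner x y"
  by (simp add: cinner_preserving_def)

text \<open>
  Stated for four vectors rather than for a map, since it is also applied to the values at a
  point of images of different functions, before any fibre map exists.
\<close>

lemma norm_diff_eq_if_cinner_eq:
  assumes "cinner a a = cinner a' a'" "cinner a b = cinner a' b'" "cinner b b = cinner b' b'"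
  shows "norm (a - b) = norm (a' - b')"
proof -
  have "inner a a = inner a' a'" "inner a b = inner a' b'" "inner b b = inner b' b'"
    using assms by (simp_all flip: Re_cinner)
  then show ?thesis
    by (simp add: norm_eq_sqrt_inner inner_diff_left inner_diff_right inner_commute)
qed

lemma cinner_preserving_norm_diff: "cinner_preserving U \<Longrightarrow> norm (U x - U y) = norm (x - y)"
  by (rule norm_diff_eq_if_cinner_eq) (simp_all add: cinner_preservingD)

lemma cinner_self_eq_0: "cinner x x = 0 \<longleftrightarrow> x = 0"
  by (simp add: cinner_self)

text \<open>
  The defect of linearity is orthogonal to the range of \<open>U\<close>, because inner products with vectors
  \<open>U z\<close> can be computed before applying \<open>U\<close>; but it is itself a combination of vectors in the range,
  so it is orthogonal to itself.
\<close>

lemma cinner_preserving_bounded_clinear: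
  assumes "cinner_preserving U"
  shows "bounded_clinear U"
proof -
  note U = cinner_preservingD[OF assms]
  have add: "U (x + y) = U x + U y" for x y
  proof -
    have "cinner (U (x + y) - (U x + U y)) (U z) = 0" for z
      by (simp add: U cinner_diff_left cinner_add_left)
    then have "cinner (U (x + y) - (U x + U y)) (U (x + y) - (U x + U y)) = 0"
      by (simp only: cinner_diff_right cinner_add_right) simp
    then show ?thesis by (simp add: cinner_self_eq_0)
  qed
  have scale: "U (a *\<^sub>C x) = a *\<^sub>C U x" for a x
  proof -
    have "cinner (U (a *\<^sub>C x) - a *\<^sub>C U x) (U z) = 0" for z
      by (simp add: U cinner_diff_left cinner_scaleC_left)
    then have "cinner (U (a *\<^sub>C x) - a *\<^sub>C U x) (U (a *\<^sub>C x) - a *\<^sub>C U x) = 0"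
      by (simp only: cinner_diff_right cinner_scaleC_right) simp
    then show ?thesis by (simp add: cinner_self_eq_0)
  qed
  have norm: "norm (U x) = norm x" for x
    by (simp add: norm_eq_sqrt_inner U flip: Re_cinner)
  have "bounded_linear U"
    using scale[of "complex_of_real _"] by (intro bounded_linear_intro[where K=1]) (simp_all add: add scaleC_of_real norm)
  with scale show ?thesis by (simp add: bounded_clinear_def)
qed

lemma unitary_op_iff:
  fixes U :: "'a::chilbert_space \<Rightarrow> 'a"
  shows "unitary_op U \<longleftrightarrow> cinner_preserving U \<and> surj U"
proof
  assume U: "unitary_op U"
  then have "bounded_clinear U" and inv: "\<And>x. cadjoint U (U x) = x" "\<And>x. U (cadjoint U x) = x"
    by (auto simp: unitary_op_def fun_eq_iff)
  then show "cinner_preserving U \<and> surj U"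
    by (metis cinner_preserving_def cinner_cadjoint surjI)
next
  assume U: "cinner_preserving U \<and> surj U"
  then have "inj U"
    using cinner_preserving_norm_diff[of U] by (metis injI norm_eq_zero right_minus_eq)
  have "cadjoint U = inv U"
  proof (rule cadjoint_eqI)
    fix x y
    show "cinner (U x) y = cinner x (inv U y)"
      using U cinner_preservingD[of U x "inv U y"] by (simp add: surj_f_inv_f)
  qed
  then show "unitary_op U"
    using U \<open>inj U\<close> by (simp add: unitary_op_def cinner_preserving_bounded_clinear fun_eq_iff surj_f_inv_f)
qed

section \<open>Integrable functions on the circle are determined by their moments\<close>

text \<open>
  Unlike the condition \<open>\<integral> \<phi> h = 0\<close>, being a multiplier is stable under
  products, so the multipliers form an algebra.  It contains \<open>z\<close> and \<open>cnj z\<close> and is closed under bounded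
  pointwise limits; from there one climbs through continuous functions and indicators of closed
  sets to indicators of Borel sets.  Allowing both powers independently in the moments avoids
  negative exponents, and makes the stability under multiplication by \<open>z\<close> and \<open>cnj z\<close> immediate.
\<close>

definition vanishing_moments :: "(complex \<Rightarrow> complex) \<Rightarrow> bool"
  where "vanishing_moments h \<longleftrightarrow> integrable circle_measure h \<and>
    (\<forall>m n. (\<integral>z. z ^ m * cnj z ^ n * h z \<partial>circle_measure) = 0)"

definition moment_multiplier :: "(complex \<Rightarrow> complex) \<Rightarrow> bool"
  where "moment_multiplier \<phi> \<longleftrightarrow> (\<forall>h. vanishing_moments h \<longrightarrow> vanishing_moments (\<lambda>z. \<phi> z * h z))"

lemma measurable_circle_monomial [measurable]:
  "(\<lambda>z. z ^ m * cnj z ^ n) \<in> borel_measurable circle_measure"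
  by (rule measurable_compose[OF measurable_circle_id])
    (intro borel_measurable_continuous_onI continuous_intros)

lemma norm_circle_monomial: "z \<in> sphere 0 1 \<Longrightarrow> norm (z ^ m * cnj z ^ n) = 1"
  by (simp add: norm_mult norm_power)

lemma integrable_circle_monomial:
  assumes "integrable circle_measure h"
  shows "integrable circle_measure (\<lambda>z. z ^ m * cnj z ^ n * h z)"
proof (rule Bochner_Integration.integrable_bound[OF assms])
  have [measurable]: "h \<in> borel_measurable circle_measure"
    using assms by simp
  show "(\<lambda>z. z ^ m * cnj z ^ n * h z) \<in> borel_measurable circle_measure"
    by measurable
  show "AE z in circle_measure. norm (z ^ m * cnj z ^ n * h z) \<le> norm (h z)"
    by (rule AE_I2) (simp add: norm_mult norm_power)
qed

lemma moment_multiplier_monomial: "moment_multiplier (\<lambda>z. z ^ k * cnj z ^ l)"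
  unfolding moment_multiplier_def
proof (intro allI impI)
  fix h assume h: "vanishing_moments h"
  have "(\<lambda>z. z ^ m * cnj z ^ n * (z ^ k * cnj z ^ l * h z)) = (\<lambda>z. z ^ (m + k) * cnj z ^ (n + l) * h z)" for m n
    by (simp add: power_add ac_simps)
  with h show "vanishing_moments (\<lambda>z. z ^ k * cnj z ^ l * h z)"
    unfolding vanishing_moments_def using integrable_circle_monomial by presburger
qed

lemma moment_multiplier_mult:
  assumes "moment_multiplier \<phi>" "moment_multiplier \<psi>"
  shows "moment_multiplier (\<lambda>z. \<phi> z * \<psi> z)"
  using assms by (simp add: moment_multiplier_def mult.assoc)

lemma moment_multiplier_const: "moment_multiplier (\<lambda>z. c)"
proof -
  have "z ^ m * cnj z ^ n * (c * h z) = c * (z ^ m * cnj z ^ n * h z)" for m n z and h :: "complex \<Rightarrow> complex"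
    by simp
  then show ?thesis
    by (simp only: moment_multiplier_def vanishing_moments_def integral_mult_right_zero) simp
qed

lemma moment_multiplier_add:
  assumes "moment_multiplier \<phi>" "moment_multiplier \<psi>"
  shows "moment_multiplier (\<lambda>z. \<phi> z + \<psi> z)"
  unfolding moment_multiplier_def
proof (intro allI impI)
  fix h assume "vanishing_moments h"
  then have "vanishing_moments (\<lambda>z. \<phi> z * h z)" "vanishing_moments (\<lambda>z. \<psi> z * h z)"
    using assms by (simp_all add: moment_multiplier_def)
  then show "vanishing_moments (\<lambda>z. (\<phi> z + \<psi> z) * h z)"
    unfolding vanishing_moments_def distrib_right distrib_left
    by (simp add: integrable_circle_monomial)
qed

lemma moment_multiplier_diff:
  assumes "moment_multiplier \<phi>" "moment_multiplier \<psi>"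
  shows "moment_multiplier (\<lambda>z. \<phi> z - \<psi> z)"
  using moment_multiplier_add[OF assms(1) moment_multiplier_mult[OF moment_multiplier_const[of "-1"] assms(2)]]
  by simp

text \<open>
  Dominated convergence, with a multiple of \<open>\<bar>h\<bar>\<close> as the majorant.
\<close>

lemma moment_multiplier_limit:
  assumes \<phi>: "\<And>k::nat. moment_multiplier (\<phi> k)"
    and bound: "\<And>k z. z \<in> sphere 0 1 \<Longrightarrow> norm (\<phi> k z) \<le> B"
    and lim: "\<And>z. z \<in> sphere 0 1 \<Longrightarrow> (\<lambda>k. \<phi> k z) \<longlonglongrightarrow> \<psi> z"
  shows "moment_multiplier \<psi>"
  unfolding moment_multiplier_def
proof (intro allI impI)
  fix h assume h: "vanishing_moments h"
  let ?w = "\<lambda>z. B * norm (h z)"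
  have h_int: "integrable circle_measure h"
    using h by (simp add: vanishing_moments_def)
  have \<phi>h: "vanishing_moments (\<lambda>z. \<phi> k z * h z)" for k
    using \<phi> h by (simp add: moment_multiplier_def)
  have meas: "(\<lambda>z. \<phi> k z * h z) \<in> borel_measurable circle_measure" for k
    using \<phi>h[of k] by (auto simp: vanishing_moments_def intro: borel_measurable_integrable)
  have w: "integrable circle_measure ?w"
    using h_int by simp
  have meas_lim: "(\<lambda>z. \<psi> z * h z) \<in> borel_measurable circle_measure"
    by (rule borel_measurable_LIMSEQ_metric[OF meas]) (auto intro!: tendsto_intros lim)
  have norm_le: "norm (\<phi> k z * h z) \<le> ?w z" if "z \<in> sphere 0 1" for k z
    using bound[OF that] by (simp add: norm_mult mult_right_mono)
  have "integrable circle_measure (\<lambda>z. \<psi> z * h z)"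
    by (rule integrable_dominated_convergence[OF meas_lim meas w])
      (use norm_le in \<open>auto intro!: AE_I2 tendsto_intros lim\<close>)
  moreover have "(\<integral>z. z ^ m * cnj z ^ n * (\<psi> z * h z) \<partial>circle_measure) = 0" for m n
  proof -
    have "(\<lambda>k. \<integral>z. z ^ m * cnj z ^ n * (\<phi> k z * h z) \<partial>circle_measure)
        \<longlonglongrightarrow> (\<integral>z. z ^ m * cnj z ^ n * (\<psi> z * h z) \<partial>circle_measure)"
    proof (rule integral_dominated_convergence[OF _ _ w])
      show "AE z in circle_measure. norm (z ^ m * cnj z ^ n * (\<phi> k z * h z)) \<le> ?w z" for k
      proof (rule AE_I2)
        fix z assume "z \<in> space circle_measure"
        then show "norm (z ^ m * cnj z ^ n * (\<phi> k z * h z)) \<le> ?w z"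
          using norm_le[of z k] norm_circle_monomial[of z m n]
          by (simp only: norm_mult space_circle_measure mult_1)
      qed
    qed (use meas meas_lim in \<open>auto intro!: AE_I2 tendsto_intros lim borel_measurable_times measurable_circle_monomial\<close>)
    then show ?thesis
      using \<phi>h by (simp add: vanishing_moments_def LIMSEQ_const_iff)
  qed
  ultimately show "vanishing_moments (\<lambda>z. \<psi> z * h z)"
    by (simp add: vanishing_moments_def)
qed

text \<open>
  A real linear functional on \<^typ>\<open>complex\<close> has the form \<open>z \<mapsto> a z + cnj a cnj z\<close>, which is a
  combination of two monomials; sums and products of multipliers are multipliers.
\<close>

lemma moment_multiplier_real_polynomial:
  fixes p :: "complex \<Rightarrow> real"
  assumes "real_polynomial_function p"
  shows "moment_multiplier (\<lambda>z. complex_of_real (p z))"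
  using assms
proof induction
  case (linear p)
  interpret bounded_linear p by fact
  define a where "a = (complex_of_real (p 1) - \<i> * complex_of_real (p \<i>)) / 2"
  have p: "p z = Re z * p 1 + Im z * p \<i>" for z
  proof -
    have "z = Re z *\<^sub>R 1 + Im z *\<^sub>R \<i>"
      by (simp add: complex_eq_iff)
    then show ?thesis by (metis add scaleR real_scaleR_def)
  qed
  have "complex_of_real (p z) = a * (z ^ 1 * cnj z ^ 0) + cnj a * (z ^ 0 * cnj z ^ 1)" for z
    unfolding p[of z] by (simp add: a_def complex_eq_iff field_simps)
  moreover have "moment_multiplier (\<lambda>z. a * (z ^ 1 * cnj z ^ 0) + cnj a * (z ^ 0 * cnj z ^ 1))"
    by (intro moment_multiplier_add moment_multiplier_mult moment_multiplier_const moment_multiplier_monomial)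
  ultimately show ?case by simp
qed (simp_all add: moment_multiplier_const moment_multiplier_add moment_multiplier_mult)

text \<open>
  By the Stone--Weierstrass theorem on the circle.
\<close>

lemma moment_multiplier_continuous:
  fixes \<phi> :: "complex \<Rightarrow> real"
  assumes "continuous_on (sphere 0 1) \<phi>"
  shows "moment_multiplier (\<lambda>z. complex_of_real (\<phi> z))"
proof -
  have "\<exists>p. real_polynomial_function p \<and> (\<forall>z\<in>sphere 0 1. \<bar>\<phi> z - p z\<bar> < 1 / real (Suc k))" for k
    by (rule Stone_Weierstrass_real_polynomial_function[OF compact_sphere assms, of "1 / real (Suc k)"]) auto
  then obtain p where p: "\<And>k. real_polynomial_function (p k)"
    and approx: "\<And>k z. z \<in> sphere 0 1 \<Longrightarrow> \<bar>\<phi> z - p k z\<bar> < 1 / real (Suc k)"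
    by metis
  have "bounded (\<phi> ` sphere 0 1)"
    by (intro compact_imp_bounded compact_continuous_image assms compact_sphere)
  then obtain B where B: "\<And>z. z \<in> sphere 0 1 \<Longrightarrow> \<bar>\<phi> z\<bar> \<le> B"
    unfolding bounded_iff real_norm_def by blast
  show ?thesis
  proof (rule moment_multiplier_limit[where \<phi>="\<lambda>k z. complex_of_real (p k z)" and B="B + 1"])
    fix k and z :: complex assume z: "z \<in> sphere 0 1"
    have "1 / real (Suc k) \<le> 1" by simp
    with approx[OF z, of k] B[OF z] show "norm (complex_of_real (p k z)) \<le> B + 1"
      unfolding norm_of_real by linarith
  next
    fix z :: complex assume z: "z \<in> sphere 0 1"
    have "(\<lambda>k. p k z - \<phi> z) \<longlonglongrightarrow> 0"
      by (rule LIMSEQ_norm_0) (use approx[OF z] in \<open>simp add: abs_minus_commute\<close>)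
    then have "(\<lambda>k. p k z) \<longlonglongrightarrow> \<phi> z"
      by (rule Lim_null[THEN iffD2])
    then show "(\<lambda>k. complex_of_real (p k z)) \<longlonglongrightarrow> complex_of_real (\<phi> z)"
      by (rule tendsto_of_real)
  qed (rule moment_multiplier_real_polynomial[OF p])
qed

text \<open>
  The continuous functions \<open>max 0 (1 - k d(z, F))\<close> decrease to the indicator of a nonempty \<open>F\<close>.
  The empty set is separate because \<^const>\<open>infdist\<close> is \<open>0\<close> there by convention.
\<close>

lemma moment_multiplier_closed:
  assumes "closed F"
  shows "moment_multiplier (indicator F)"
proof (cases "F = {}")
  case True
  then have "indicator F = (\<lambda>z. 0 :: complex)" by auto
  then show ?thesis by (simp only: moment_multiplier_const)
next
  case False
  show ?thesis
  proof (rule moment_multiplier_limit[where B=1 and \<phi>="\<lambda>k z. complex_of_real (max 0 (1 - real k * infdist z F))"])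
    show "moment_multiplier (\<lambda>z. complex_of_real (max 0 (1 - real k * infdist z F)))" for k
      by (intro moment_multiplier_continuous continuous_intros)
    show "norm (complex_of_real (max 0 (1 - real k * infdist z F))) \<le> 1" for k z
      by (simp only: norm_of_real) (simp add: infdist_nonneg)
  next
    fix z :: complex
    have "eventually (\<lambda>k. complex_of_real (max 0 (1 - real k * infdist z F)) = indicator F z) sequentially"
    proof (cases "z \<in> F")
      case True
      then show ?thesis by simp
    next
      case out: False
      then have pos: "0 < infdist z F"
        using infdist_pos_not_in_closed[OF assms] False by simp
      then obtain k where k: "1 < real k * infdist z F"
        using reals_Archimedean3 by blast
      show ?thesis
      proof (rule eventually_sequentiallyI)
        fix l assume "k \<le> l"
        then have "real k * infdist z F \<le> real l * infdist z F"
          using pos by simp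
        with k out show "complex_of_real (max 0 (1 - real l * infdist z F)) = indicator F z"
          by simp
      qed
    qed
    then show "(\<lambda>k. complex_of_real (max 0 (1 - real k * infdist z F))) \<longlonglongrightarrow> indicator F z"
      by (rule tendsto_eventually)
  qed
qed

text \<open>
  Because multipliers form an algebra closed under bounded limits, the sets whose indicators are
  multipliers form a \<open>\<sigma>\<close>-algebra.
\<close>

lemma moment_multiplier_borel:
  assumes "A \<in> sets borel"
  shows "moment_multiplier (indicator A)"
proof -
  have union: "moment_multiplier (indicator (A \<union> B))"
    if "moment_multiplier (indicator A)" "moment_multiplier (indicator B)" for A B
  proof -
    have "indicator (A \<union> B) = (\<lambda>z. indicator A z + indicator B z - indicator A z * indicator B z :: complex)"
      by (auto simp: fun_eq_iff indicator_def)
    with that show ?thesis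
      by (simp add: moment_multiplier_add moment_multiplier_diff moment_multiplier_mult)
  qed
  have "A \<in> sigma_sets UNIV (Collect closed)"
    using assms by (simp add: borel_eq_closed)
  then show ?thesis
  proof induction
    case Empty
    show ?case by (rule moment_multiplier_closed[OF closed_empty])
  next
    case (Compl A)
    have "indicator (UNIV - A) = (\<lambda>z. 1 - indicator A z :: complex)"
      by (auto simp: fun_eq_iff indicator_def)
    with Compl show ?case
      by (simp add: moment_multiplier_const moment_multiplier_diff)
  next
    case (Union A)
    have fin: "moment_multiplier (indicator (\<Union>i<n. A i))" for n :: nat
    proof (induction n)
      case 0
      show ?case by (simp only: lessThan_0 UN_empty moment_multiplier_closed[OF closed_empty])
    next
      case (Suc n)
      then show ?case using union[OF Union.IH[of n]] by (simp add: lessThan_Suc)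
    qed
    show ?case
    proof (rule moment_multiplier_limit[OF fin, where B=1])
      fix z :: complex
      show "(\<lambda>n. indicator (\<Union>i<n. A i) z :: complex) \<longlonglongrightarrow> indicator (\<Union>i. A i) z"
        by (rule LIMSEQ_indicator_UN)
    qed (simp add: indicator_def)
  qed (simp add: moment_multiplier_closed)
qed

text \<open>
  The integral of \<open>h\<close> over a Borel set \<open>S\<close> is the zeroth moment of the product of \<open>h\<close> with the
  indicator of \<open>S\<close>.  A set of the completed \<open>\<sigma>\<close>-algebra differs from a Borel set by a null set.
\<close>

lemma vanishing_moments_AE_zero:
  assumes "vanishing_moments h"
  shows "AE z in circle_measure. h z = 0"
proof (rule circle.density_zero)
  show "integrable circle_measure h"
    using assms by (simp add: vanishing_moments_def)
  fix A assume "A \<in> sets circle_measure"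
  then obtain S N N' where A: "A = S \<union> N" "N \<subseteq> N'" and N': "N' \<in> null_sets circle_borel"
    and S: "S \<in> sets circle_borel"
    unfolding circle_measure_def by (rule sets_completionE)
  have "S \<in> sets borel"
    using S by (simp add: circle_borel_def sets_restrict_space_iff)
  then have "vanishing_moments (\<lambda>z. indicator S z * h z)"
    using moment_multiplier_borel assms unfolding moment_multiplier_def by blast
  then have int: "integrable circle_measure (\<lambda>z. indicator S z * h z)"
    and "(\<integral>z. z ^ 0 * cnj z ^ 0 * (indicator S z * h z) \<partial>circle_measure) = 0"
    unfolding vanishing_moments_def by blast+
  then have zero: "(\<integral>z. indicator S z * h z \<partial>circle_measure) = 0"
    by simp
  have "AE z in circle_measure. z \<notin> N'"
    unfolding circle_measure_def by (intro AE_completion AE_not_in N')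
  then have "AE z in circle_measure. indicator S z * h z = indicator A z *\<^sub>R h z"
    by eventually_elim (use A in \<open>auto simp: indicator_def\<close>)
  then have "(\<integral>z. indicator A z *\<^sub>R h z \<partial>circle_measure) = (\<integral>z. indicator S z * h z \<partial>circle_measure)"
    using \<open>integrable circle_measure h\<close> \<open>A \<in> sets circle_measure\<close> int
    by (intro integral_cong_AE) (auto elim!: eventually_mono)
  then show "set_lebesgue_integral circle_measure A h = 0"
    by (simp add: set_lebesgue_integral_def zero)
qed

section \<open>The space $L^2(\mathcal{H})$\<close>

lemma cinner_L2_cong:
  assumes "AE z in circle_measure. cinner (rep_L2 f z) (rep_L2 g z) = cinner (rep_L2 f' z) (rep_L2 g' z)"
  shows "cinner f g = cinner f' g'"
  unfolding cinner_circle_L2.rep_eq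
  by (intro integral_cong_AE assms borel_measurable_integrable integrable_cinner square_integrable_rep_L2)

text \<open>
  The measure is complete, so agreeing almost everywhere with a measurable function makes \<open>f\<close>
  itself measurable.  Hence the values of the operator of multiplication by the pointwise adjoint
  can be found below by comparing functions almost everywhere.
\<close>

lemma abs_L2_eqI:
  assumes "AE z in circle_measure. f z = rep_L2 g z"
  shows "abs_L2 f = g"
proof -
  have "f \<in> borel_measurable circle_measure"
  proof (rule measurableI)
    fix A :: "'a set" assume A: "A \<in> sets borel"
    have "rep_L2 g \<in> borel_measurable circle_measure"
      using square_integrable_rep_L2[of g] by (simp add: square_integrable_def)
    then have sets: "rep_L2 g -` A \<inter> space circle_measure \<in> sets circle_measure"
      using A by (rule measurable_sets)
    have "AE z in circle_measure. z \<in> rep_L2 g -` A \<inter> space circle_measure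
        \<longleftrightarrow> z \<in> f -` A \<inter> space circle_measure"
      using assms by eventually_elim simp
    from this sets show "f -` A \<inter> space circle_measure \<in> sets circle_measure"
      by (rule circle.in_sets_AE) blast
  qed simp
  moreover have "AE z in circle_measure. norm (f z) \<le> 1 * norm (rep_L2 g z)"
    using assms by eventually_elim simp
  ultimately have "square_integrable f"
    by (rule square_integrable_bound[OF square_integrable_rep_L2])
  then have "AE z in circle_measure. rep_L2 (abs_L2 f) z = f z"
    by (rule rep_abs_L2)
  with assms have "AE z in circle_measure. rep_L2 (abs_L2 f) z = rep_L2 g z"
    by eventually_elim simp
  then show ?thesis by (rule L2_eqI)
qed

lemma mult_op_eqI:
  assumes "AE z in circle_measure. F z (rep_L2 f z) = rep_L2 g z"
  shows "mult_op F f = g"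
  unfolding mult_op_def using assms by (rule abs_L2_eqI)

lemma cinner_preserving_mult_op:
  assumes "F \<in> Linf_op" and "AE z in circle_measure. cinner_preserving (F z)"
  shows "cinner_preserving (mult_op F)"
  unfolding cinner_preserving_def
proof (intro allI)
  fix f g
  show "cinner (mult_op F f) (mult_op F g) = cinner f g"
  proof (rule cinner_L2_cong)
    show "AE z in circle_measure. cinner (rep_L2 (mult_op F f) z) (rep_L2 (mult_op F g) z)
        = cinner (rep_L2 f z) (rep_L2 g z)"
      using rep_mult_op[OF assms(1), of f] rep_mult_op[OF assms(1), of g] assms(2)
      by eventually_elim (simp add: cinner_preservingD)
  qed
qed

lemma mult_op_cadjoint_mult_op:
  assumes F: "F \<in> Linf_op" and U: "AE z in circle_measure. unitary_op (F z)"
  shows "mult_op (\<lambda>z. cadjoint (F z)) (mult_op F f) = f"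
proof (rule mult_op_eqI)
  show "AE z in circle_measure. cadjoint (F z) (rep_L2 (mult_op F f) z) = rep_L2 f z"
    using rep_mult_op[OF F, of f] U
    by eventually_elim (simp add: unitary_op_def fun_eq_iff)
qed

lemma AE_circle_cnj:
  assumes "AE z in circle_measure. P z"
  shows "AE z in circle_measure. P (cnj z)"
  by (rule AE_distrD[OF measurable_cnj_circle, unfolded distr_cnj_circle, OF assms])

text \<open>
  The two hypotheses give \<open>\<langle>C x, w\<rangle> = \<langle>C w, x\<rangle>\<close>.  The right-hand side is antilinear in \<open>x\<close>, so
  testing against all \<open>w\<close> shows that \<open>C\<close> is antilinear.
\<close>

lemma conjugationI:
  assumes inv: "\<And>x. C (C x) = x" and C: "\<And>x y. cinner (C x) (C y) = cinner y x"
  shows "conjugation C"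
proof -
  have move: "cinner (C x) w = cinner (C w) x" for x w
    using C[of x "C w"] by (simp add: inv)
  have eqI: "u = v" if "\<And>w. cinner u w = cinner v w" for u v :: 'a
    using that[of "u - v"] cinner_self_eq_0[of "u - v"] by (simp add: cinner_diff_left)
  show ?thesis
    unfolding conjugation_def
  proof (intro conjI allI)
    show "C (x + y) = C x + C y" for x y
      by (rule eqI) (simp add: move cinner_add_left cinner_add_right)
    show "C (a *\<^sub>C x) = cnj a *\<^sub>C C x" for a x
      by (rule eqI) (simp add: move cinner_scaleC_left cinner_scaleC_right)
  qed (auto simp: inv C)
qed

lemma conjugation_conj_star:
  fixes J :: "'h::{chilbert_space,second_countable_topology} \<Rightarrow> 'h"
  assumes J: "conjugation J"
  shows "conjugation (conj_star J)"
proof (rule conjugationI)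
  fix f :: "'h circle_L2"
  show "conj_star J (conj_star J f) = f"
  proof (rule L2_eqI)
    show "AE z in circle_measure. rep_L2 (conj_star J (conj_star J f)) z = rep_L2 f z"
      using rep_conj_star[OF J, of "conj_star J f"] AE_circle_cnj[OF rep_conj_star[OF J, of f]]
      by eventually_elim (use J in \<open>simp add: conjugation_def fun_eq_iff\<close>)
  qed
next
  fix f g :: "'h circle_L2"
  have meas: "(\<lambda>z. cinner (rep_L2 g z) (rep_L2 f z)) \<in> borel_measurable circle_measure"
    by (intro borel_measurable_integrable integrable_cinner square_integrable_rep_L2)
  have "cinner (conj_star J f) (conj_star J g)
      = (\<integral>z. cinner (rep_L2 g (cnj z)) (rep_L2 f (cnj z)) \<partial>circle_measure)"
    unfolding cinner_circle_L2.rep_eq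
  proof (rule integral_cong_AE)
    show "AE z in circle_measure. cinner (rep_L2 (conj_star J f) z) (rep_L2 (conj_star J g) z)
        = cinner (rep_L2 g (cnj z)) (rep_L2 f (cnj z))"
      using rep_conj_star[OF J, of f] rep_conj_star[OF J, of g]
      by eventually_elim (use J in \<open>simp add: conjugation_def\<close>)
    show "(\<lambda>z. cinner (rep_L2 (conj_star J f) z) (rep_L2 (conj_star J g) z)) \<in> borel_measurable circle_measure"
      by (intro borel_measurable_integrable integrable_cinner square_integrable_rep_L2)
  qed (rule measurable_compose[OF measurable_cnj_circle meas])
  also have "\<dots> = (\<integral>z. cinner (rep_L2 g z) (rep_L2 f z) \<partial>distr circle_measure circle_measure cnj)"
    by (rule integral_distr[symmetric, OF measurable_cnj_circle meas])
  also have "\<dots> = cinner g f"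
    by (simp add: distr_cnj_circle cinner_circle_L2.rep_eq)
  finally show "cinner (conj_star J f) (conj_star J g) = cinner g f" .
qed

text \<open>
  The factor \<open>z\<close> becomes \<open>cnj z\<close> under the reflection of the circle and again \<open>z\<close> when it is pulled
  out of the antilinear \<open>J\<close>.
\<close>

lemma conj_star_shift_op:
  assumes J: "conjugation J"
  shows "conj_star J (shift_op f) = shift_op (conj_star J f)"
proof (rule L2_eqI)
  show "AE z in circle_measure. rep_L2 (conj_star J (shift_op f)) z = rep_L2 (shift_op (conj_star J f)) z"
    using rep_conj_star[OF J, of "shift_op f"] rep_conj_star[OF J, of f]
      AE_circle_cnj[OF rep_shift_op[of f]] rep_shift_op[of "conj_star J f"]
    by eventually_elim (use J in \<open>simp add: conjugation_def\<close>)
qed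

lemma mult_op_shift_op:
  assumes F: "F \<in> Linf_op"
  shows "mult_op F (shift_op f) = shift_op (mult_op F f)"
proof (rule L2_eqI)
  have lin: "bounded_clinear (F z)" if "z \<in> sphere 0 1" for z
    using F that by (simp add: Linf_op_def)
  show "AE z in circle_measure. rep_L2 (mult_op F (shift_op f)) z = rep_L2 (shift_op (mult_op F f)) z"
    using rep_mult_op[OF F, of "shift_op f"] rep_mult_op[OF F, of f] rep_shift_op[of f]
      rep_shift_op[of "mult_op F f"] AE_space
    by eventually_elim (use lin in \<open>simp add: bounded_clinear_def\<close>)
qed

section \<open>Isometries commuting with the shift\<close>

lemma rep_shift_op_power:
  "AE z in circle_measure. rep_L2 ((shift_op ^^ n) f) z = z ^ n *\<^sub>C rep_L2 f z"
proof (induction n)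
  case 0
  show ?case using scaleC_of_real[of 1 "rep_L2 f _"] by simp
next
  case (Suc n)
  then show ?case
    using rep_shift_op[of "(shift_op ^^ n) f"]
    by eventually_elim (simp add: scaleC_scaleC)
qed

text \<open>
  The powers of \<open>z\<close> are absorbed into the left argument, those of \<open>cnj z\<close> into the right one.
\<close>

lemma moment_cinner:
  "(\<integral>z. z ^ m * cnj z ^ n * cinner (rep_L2 f z) (rep_L2 g z) \<partial>circle_measure)
    = cinner ((shift_op ^^ m) f) ((shift_op ^^ n) g)"
  unfolding cinner_circle_L2.rep_eq
proof (rule integral_cong_AE)
  show "AE z in circle_measure. z ^ m * cnj z ^ n * cinner (rep_L2 f z) (rep_L2 g z)
      = cinner (rep_L2 ((shift_op ^^ m) f) z) (rep_L2 ((shift_op ^^ n) g) z)"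
    using rep_shift_op_power[of m f] rep_shift_op_power[of n g]
    by eventually_elim (simp add: cinner_scaleC_left cinner_scaleC_right)
qed (intro borel_measurable_integrable integrable_circle_monomial integrable_cinner square_integrable_rep_L2)+

lemma shift_isometry_pointwise:
  fixes T :: "'h::{chilbert_space,second_countable_topology} circle_L2 \<Rightarrow> 'h circle_L2"
  assumes T: "cinner_preserving T" and comm: "\<And>f. T (shift_op f) = shift_op (T f)"
  shows "AE z in circle_measure.
    cinner (rep_L2 (T f) z) (rep_L2 (T g) z) = cinner (rep_L2 f z) (rep_L2 g z)"
proof -
  let ?Tfg = "\<lambda>z. cinner (rep_L2 (T f) z) (rep_L2 (T g) z)" and ?fg = "\<lambda>z. cinner (rep_L2 f z) (rep_L2 g z)"
  have int: "integrable circle_measure (\<lambda>z. z ^ m * cnj z ^ n * cinner (rep_L2 f z) (rep_L2 g z))" for m n and f g :: "'h circle_L2"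
    by (intro integrable_circle_monomial integrable_cinner square_integrable_rep_L2)
  have power: "T ((shift_op ^^ n) f) = (shift_op ^^ n) (T f)" for n f
    by (induction n) (simp_all add: comm)
  have "(\<integral>z. z ^ m * cnj z ^ n * (?Tfg z - ?fg z) \<partial>circle_measure) = 0" for m n
    unfolding right_diff_distrib
    by (subst Bochner_Integration.integral_diff[OF int int])
      (simp only: moment_cinner power[symmetric] cinner_preservingD[OF T] diff_self)
  then have "vanishing_moments (\<lambda>z. ?Tfg z - ?fg z)"
    by (simp add: vanishing_moments_def integrable_cinner square_integrable_rep_L2)
  then show ?thesis
    by (auto dest: vanishing_moments_AE_zero)
qed

lemma cinner_tendsto:
  assumes "(f \<longlongrightarrow> a) F" "(g \<longlongrightarrow> b) F"
  shows "((\<lambda>n. cinner (f n) (g n)) \<longlongrightarrow> cinner a b) F"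
  unfolding cinner_eq_Complex
  by (intro tendsto_Complex tendsto_inner assms bounded_linear.tendsto[OF bounded_linear_scaleC])

lemma isometric_on_Cauchy:
  assumes "\<And>m n :: nat. norm (y m - y n) = norm (x m - x n)" and "x \<longlonglongrightarrow> l"
  shows "Cauchy y"
proof -
  have "Cauchy x"
    using assms(2) by (rule LIMSEQ_imp_Cauchy)
  then show ?thesis
    by (simp add: Cauchy_def dist_norm assms(1))
qed

text \<open>
  The range of an isometry on a complete space is complete, hence closed.
\<close>

lemma dense_range_imp_surj:
  fixes U :: "'a::{real_normed_vector,complete_space} \<Rightarrow> 'b::real_normed_vector"
  assumes iso: "\<And>x y. norm (U x - U y) = norm (x - y)"
    and dense: "\<And>y. \<exists>w. (\<lambda>n::nat. U (w n)) \<longlonglongrightarrow> y"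
  shows "surj U"
proof (rule surjI)
  fix y
  obtain w where w: "(\<lambda>n::nat. U (w n)) \<longlonglongrightarrow> y"
    using dense by blast
  have "Cauchy w"
    by (rule isometric_on_Cauchy[OF _ w]) (simp add: iso)
  then obtain l where l: "w \<longlonglongrightarrow> l"
    using Cauchy_convergent_iff convergent_def by blast
  have "(\<lambda>n. norm (U (w n) - U l)) \<longlonglongrightarrow> 0"
    unfolding iso using l by (simp add: LIM_zero_iff tendsto_norm_zero)
  then have "(\<lambda>n. U (w n)) \<longlonglongrightarrow> U l"
    by (simp add: tendsto_norm_zero_iff LIM_zero_iff)
  with w have "U l = y"
    using LIMSEQ_unique by blast
  then show "U (SOME x. U x = y) = y"
    by (rule someI)
qed

text \<open>
  A choice \<open>d\<close> of approximating sequences from one countable set: almost everywhere statements can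
  then be combined over the whole set, and the extension by continuity is an explicit limit whose
  measurability is evident.
\<close>

lemma countable_dense_sequences:
  obtains D :: "'a::{metric_space,second_countable_topology} set" and d :: "'a \<Rightarrow> nat \<Rightarrow> 'a"
  where "countable D" "\<And>x n. d x n \<in> D" "\<And>x. d x \<longlonglongrightarrow> x"
proof -
  obtain D :: "'a set" where D: "countable D" and dense: "\<And>X. open X \<Longrightarrow> X \<noteq> {} \<Longrightarrow> \<exists>d\<in>D. d \<in> X"
    by (rule countable_dense_setE, rule that)
  have "\<exists>d\<in>D. dist d x < 1 / real (Suc n)" for x n
    using dense[of "ball x (1 / real (Suc n))"] by (auto simp: dist_commute)
  then obtain d where dD: "\<And>x n. d x n \<in> D" and d: "\<And>x n. dist (d x n) x < 1 / real (Suc n)"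
    by metis
  have "d x \<longlonglongrightarrow> x" for x
    unfolding tendsto_dist_iff[of _ x] by (rule LIMSEQ_norm_0) (use d in simp)
  with D dD show ?thesis by (rule that)
qed

lemma square_integrable_const: "square_integrable (\<lambda>z. x)"
  by (simp add: square_integrable_def)

lemma Linf_op_isometryI:
  assumes "\<And>z. cinner_preserving (U z)" and "\<And>x. (\<lambda>z. U z x) \<in> borel_measurable circle_measure"
  shows "U \<in> Linf_op"
proof -
  have "onorm (U z) \<le> 1" for z
  proof (rule onorm_bound)
    show "norm (U z x) \<le> 1 * norm x" for x
      using cinner_preservingD[OF assms(1), of z x x] by (simp add: norm_eq_sqrt_inner flip: Re_cinner)
  qed simp
  then show ?thesis
    using assms by (auto simp: Linf_op_def cinner_preserving_bounded_clinear)
qed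

text \<open>
  The fibre map \<open>U z\<close> extends \<open>x \<mapsto> u x z\<close> from the dense set \<open>D\<close>.  That \<open>T\<close> acts as \<open>U z\<close> on the value of
  an arbitrary \<open>f\<close> follows from the pointwise isometry for the pairs consisting of \<open>f\<close> and a constant.
\<close>

lemma shift_isometry_is_mult_op:
  fixes T :: "'h::{chilbert_space,second_countable_topology} circle_L2 \<Rightarrow> 'h circle_L2"
  assumes T: "cinner_preserving T" and comm: "\<And>f. T (shift_op f) = shift_op (T f)"
  obtains U where "U \<in> Linf_op" "\<And>z. cinner_preserving (U z)" "T = mult_op U"
proof -
  obtain D :: "'h set" and d where D: "countable D" and dD: "\<And>x n. d x n \<in> D"
    and d_lim: "\<And>x. d x \<longlonglongrightarrow> x"
    by (rule countable_dense_sequences, rule that)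
  define u where "u x = rep_L2 (T (abs_L2 (\<lambda>_. x)))" for x
  have const: "AE z in circle_measure. rep_L2 (abs_L2 (\<lambda>_. x)) z = x" for x :: 'h
    by (rule rep_abs_L2[OF square_integrable_const])
  have T_u: "AE z in circle_measure. cinner (rep_L2 (T f) z) (u x z) = cinner (rep_L2 f z) x" for f x
    using shift_isometry_pointwise[OF T comm, of f "abs_L2 (\<lambda>_. x)"] const[of x]
    unfolding u_def by eventually_elim simp
  have u_u: "AE z in circle_measure. cinner (u x z) (u y z) = cinner x y" for x y
    using T_u[of "abs_L2 (\<lambda>_. x)" y] const[of x]
    unfolding u_def by eventually_elim simp
  have "AE z in circle_measure. \<forall>x\<in>D. \<forall>y\<in>D. cinner (u x z) (u y z) = cinner x y"
    by (intro AE_ball_countable' D u_u)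
  then obtain N where N: "N \<in> null_sets circle_measure"
    and uD: "\<And>z x y. z \<in> sphere 0 1 - N \<Longrightarrow> x \<in> D \<Longrightarrow> y \<in> D \<Longrightarrow> cinner (u x z) (u y z) = cinner x y"
    by (rule AE_E3) auto
  define good where "good = sphere 0 1 - N"
  \<comment> \<open>The identity on the exceptional null set makes every fibre map an isometry.\<close>
  define U where "U z x = (if z \<in> good then lim (\<lambda>n. u (d x n) z) else x)" for z x
  have U_lim: "(\<lambda>n. u (d x n) z) \<longlonglongrightarrow> U z x" if z: "z \<in> good" for z x
  proof -
    have "Cauchy (\<lambda>n. u (d x n) z)"
    proof (rule isometric_on_Cauchy[OF _ d_lim])
      show "norm (u (d x m) z - u (d x n) z) = norm (d x m - d x n)" for m n
        by (rule norm_diff_eq_if_cinner_eq) (use z uD dD in \<open>auto simp: good_def\<close>)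
    qed
    then show ?thesis
      using z by (simp add: U_def Cauchy_convergent_iff convergent_LIMSEQ_iff)
  qed
  have U_iso: "cinner_preserving (U z)" for z
    unfolding cinner_preserving_def
  proof (intro allI)
    fix x y
    show "cinner (U z x) (U z y) = cinner x y"
    proof (cases "z \<in> good")
      case True
      have "(\<lambda>n. cinner (u (d x n) z) (u (d y n) z)) \<longlonglongrightarrow> cinner (U z x) (U z y)"
        by (intro cinner_tendsto U_lim True)
      moreover have "(\<lambda>n. cinner (u (d x n) z) (u (d y n) z)) = (\<lambda>n. cinner (d x n) (d y n))"
        using True uD dD by (simp add: good_def)
      moreover have "(\<lambda>n. cinner (d x n) (d y n)) \<longlonglongrightarrow> cinner x y"
        by (intro cinner_tendsto d_lim)
      ultimately show ?thesis
        using LIMSEQ_unique by metis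
    qed (simp add: U_def)
  qed
  have "(\<lambda>z. U z x) \<in> borel_measurable circle_measure" for x
  proof -
    have "u y \<in> borel_measurable circle_measure" for y
      unfolding u_def using square_integrable_rep_L2 unfolding square_integrable_def by blast
    then have "(\<lambda>z. lim (\<lambda>n. u (d x n) z)) \<in> borel_measurable circle_measure"
      by (rule borel_measurable_lim_metric)
    moreover have "good \<inter> space circle_measure = space circle_measure - N"
      by (auto simp: good_def)
    then have "good \<inter> space circle_measure \<in> sets circle_measure"
      using N by (simp only: sets.Diff sets.top null_setsD2)
    ultimately show ?thesis
      unfolding U_def by (intro measurable_If_set measurable_const) simp_all
  qed
  with U_iso have U: "U \<in> Linf_op"
    by (intro Linf_op_isometryI)
  have "mult_op U f = T f" for f
  proof (rule mult_op_eqI)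
    have "AE z in circle_measure. \<forall>x\<in>D. cinner (rep_L2 (T f) z) (u x z) = cinner (rep_L2 f z) x"
      by (intro AE_ball_countable' D T_u)
    moreover have "AE z in circle_measure. z \<in> good"
      using AE_not_in[OF N] AE_space by eventually_elim (simp add: good_def)
    ultimately show "AE z in circle_measure. U z (rep_L2 f z) = rep_L2 (T f) z"
      using shift_isometry_pointwise[OF T comm, of f f]
    proof eventually_elim
      fix z
      assume Tu: "\<forall>x\<in>D. cinner (rep_L2 (T f) z) (u x z) = cinner (rep_L2 f z) x" and z: "z \<in> good"
        and TT: "cinner (rep_L2 (T f) z) (rep_L2 (T f) z) = cinner (rep_L2 f z) (rep_L2 f z)"
      let ?x = "rep_L2 f z"
      have "norm (rep_L2 (T f) z - u (d ?x n) z) = norm (?x - d ?x n)" for n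
        by (rule norm_diff_eq_if_cinner_eq) (use TT Tu z uD dD in \<open>auto simp: good_def\<close>)
      moreover have "(\<lambda>n. norm (?x - d ?x n)) \<longlonglongrightarrow> 0"
        using tendsto_norm[OF tendsto_diff[OF tendsto_const d_lim[of ?x]], of ?x] by simp
      ultimately have "(\<lambda>n. norm (u (d ?x n) z - rep_L2 (T f) z)) \<longlonglongrightarrow> 0"
        by (simp add: norm_minus_commute)
      then have "(\<lambda>n. u (d ?x n) z) \<longlonglongrightarrow> rep_L2 (T f) z"
        by (simp add: tendsto_norm_zero_iff LIM_zero_iff)
      with U_lim[OF z] show "U z ?x = rep_L2 (T f) z"
        using LIMSEQ_unique by blast
    qed
  qed
  then have "T = mult_op U"
    by auto
  with U U_iso show ?thesis
    by (rule that)
qed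

text \<open>
  Each constant function with value in a countable dense set is in the range of \<^term>\<open>mult_op U\<close>, so
  for almost every \<open>z\<close> the range of \<open>U z\<close> contains that dense set.
\<close>

lemma surj_mult_op_imp_surj_AE:
  fixes U :: "complex \<Rightarrow> 'h::{chilbert_space,second_countable_topology} \<Rightarrow> 'h"
  assumes U: "U \<in> Linf_op" and iso: "\<And>z. cinner_preserving (U z)" and surj: "surj (mult_op U)"
  shows "AE z in circle_measure. surj (U z)"
proof -
  obtain D :: "'h set" and d where D: "countable D" and dD: "\<And>x n. d x n \<in> D"
    and d_lim: "\<And>x. d x \<longlonglongrightarrow> x"
    by (rule countable_dense_sequences, rule that)
  have "AE z in circle_measure. x \<in> range (U z)" for x
  proof -
    obtain g where g: "mult_op U g = abs_L2 (\<lambda>_. x)"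
      using surj by (metis surj_def)
    show ?thesis
      using rep_mult_op[OF U, of g] rep_abs_L2[OF square_integrable_const[of x]]
      unfolding g by eventually_elim (metis rangeI)
  qed
  then have "AE z in circle_measure. \<forall>x\<in>D. x \<in> range (U z)"
    by (intro AE_ball_countable' D)
  then show ?thesis
  proof eventually_elim
    fix z assume range: "\<forall>x\<in>D. x \<in> range (U z)"
    show "surj (U z)"
    proof (rule dense_range_imp_surj)
      fix y
      have "U z (inv (U z) (d y n)) = d y n" for n
        using range dD[of y n] by (blast intro: f_inv_into_f)
      then have "(\<lambda>n. U z (inv (U z) (d y n))) \<longlonglongrightarrow> y"
        by (simp add: d_lim)
      then show "\<exists>w. (\<lambda>n. U z (w n)) \<longlonglongrightarrow> y"
        by (rule exI[of _ "\<lambda>n. inv (U z) (d y n)"])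
    qed (rule cinner_preserving_norm_diff[OF iso])
  qed
qed

section \<open>Conjugations commuting with the shift\<close>

theorem theorem4p3:
  fixes J :: "'h::{chilbert_space,second_countable_topology} \<Rightarrow> 'h"
    and C :: "'h circle_L2 \<Rightarrow> 'h circle_L2"
  assumes "conjugation J"
  shows "(conjugation C \<and> C \<circ> shift_op = shift_op \<circ> C) \<longleftrightarrow>
    (\<exists>U\<in>Linf_op.
      (AE z in circle_measure. unitary_op (U z)) \<and>
      C_symmetric (conj_star J) (mult_op U) \<and>
      C = mult_op U \<circ> conj_star J \<and>
      C = conj_star J \<circ> mult_op (\<lambda>z. cadjoint (U z)))"
proof
  let ?J = "conj_star J"
  have J: "?J (?J f) = f" and J_cinner: "cinner (?J f) (?J g) = cinner g f" for f g
    using conjugation_conj_star[OF assms] by (simp_all add: conjugation_def fun_eq_iff)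
  note J_shift = conj_star_shift_op[OF assms]
  {
    assume "conjugation C \<and> C \<circ> shift_op = shift_op \<circ> C"
    then have C: "C (C f) = f" and C_cinner: "cinner (C f) (C g) = cinner g f"
      and C_shift: "C (shift_op f) = shift_op (C f)" for f g
      by (simp_all add: conjugation_def fun_eq_iff)
    have "cinner_preserving (C \<circ> ?J)"
      by (simp add: cinner_preserving_def C_cinner J_cinner)
    moreover have "(C \<circ> ?J) (shift_op f) = shift_op ((C \<circ> ?J) f)" for f
      by (simp add: J_shift C_shift)
    ultimately obtain U where U: "U \<in> Linf_op" and iso: "\<And>z. cinner_preserving (U z)"
      and T: "C \<circ> ?J = mult_op U"
      by (rule shift_isometry_is_mult_op) auto
    have CJ: "C (?J f) = mult_op U f" for f
      using T by (metis comp_apply)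
    have "surj (mult_op U)"
      by (rule surjI[where f="\<lambda>f. ?J (C f)"]) (simp add: J C flip: CJ)
    then have "AE z in circle_measure. surj (U z)"
      by (rule surj_mult_op_imp_surj_AE[OF U iso])
    then have unitary: "AE z in circle_measure. unitary_op (U z)"
      by eventually_elim (simp add: unitary_op_iff iso)
    \<comment> \<open>Both factors of \<open>M\<^sub>U = C J\<^sup>\<star>\<close> are involutions reversing the inner product.\<close>
    have "cadjoint (mult_op U) = ?J \<circ> C"
    proof (rule cadjoint_eqI)
      show "cinner (mult_op U f) g = cinner f ((?J \<circ> C) g)" for f g
        using C_cinner[of "?J f" "C g"] J_cinner[of "?J f" "C g"] by (simp add: J C flip: CJ)
    qed
    then have "C_symmetric ?J (mult_op U)"
      using U iso by (simp add: C_symmetric_def cinner_preserving_bounded_clinear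
          cinner_preserving_mult_op fun_eq_iff J flip: CJ)
    moreover have "C f = (?J \<circ> mult_op (\<lambda>z. cadjoint (U z))) f" for f
      using mult_op_cadjoint_mult_op[OF U unitary, of "?J (C f)"] by (simp add: J C flip: CJ)
    moreover have "C = mult_op U \<circ> ?J"
      by (simp add: fun_eq_iff J flip: CJ)
    ultimately show "\<exists>U\<in>Linf_op. (AE z in circle_measure. unitary_op (U z)) \<and>
        C_symmetric ?J (mult_op U) \<and> C = mult_op U \<circ> ?J \<and> C = ?J \<circ> mult_op (\<lambda>z. cadjoint (U z))"
      using U unitary by blast
  next
    assume "\<exists>U\<in>Linf_op. (AE z in circle_measure. unitary_op (U z)) \<and>
        C_symmetric ?J (mult_op U) \<and> C = mult_op U \<circ> ?J \<and> C = ?J \<circ> mult_op (\<lambda>z. cadjoint (U z))"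
    then obtain U where U: "U \<in> Linf_op" and unitary: "AE z in circle_measure. unitary_op (U z)"
      and C1: "\<And>f. C f = mult_op U (?J f)" and C2: "\<And>f. C f = ?J (mult_op (\<lambda>z. cadjoint (U z)) f)"
      by (metis comp_apply)
    have "AE z in circle_measure. cinner_preserving (U z)"
      using unitary by eventually_elim (simp add: unitary_op_iff)
    then have iso: "cinner_preserving (mult_op U)"
      by (rule cinner_preserving_mult_op[OF U])
    have "conjugation C"
    proof (rule conjugationI)
      show "C (C f) = f" for f
        unfolding C2[of "C f"] by (simp only: C1 mult_op_cadjoint_mult_op[OF U unitary] J)
      show "cinner (C f) (C g) = cinner g f" for f g
        by (simp add: C1 cinner_preservingD[OF iso] J_cinner)
    qed
    then show "conjugation C \<and> C \<circ> shift_op = shift_op \<circ> C"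
      by (simp add: fun_eq_iff C1 J_shift mult_op_shift_op[OF U])
  }
qed

end
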